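(* Let $\alpha,\beta,\gamma,\rho,a\in\mathbb{C}$ with $\operatorname{Re}(\alpha)>0$ and $a\ne0$, and let $\mu$ be a real number, such that $\mu>0$ and $\operatorname{Re}(\rho)>\max\{0,\operatorname{Re}(-\alpha-\beta-\gamma)\}$. Then for every $x>0$, $$\left(\mathcal{D}_{0+}^{\alpha,\beta,\gamma}\left(t^{\rho-1}I^{m,n}_{p,q}\left[at^{\mu}\,\middle|\begin{matrix}(a_i,A_i,\alpha_i)_{1,p}\\(b_j,B_j,\beta_j)_{1,q}\end{matrix}\right]\right)\right)(x)=x^{\beta+\rho-1}\,I^{m,n+2}_{p+2,q+2}\left[ax^{\mu}\,\middle|\begin{matrix}(1-\rho,\mu,1),\ (1-\alpha-\beta-\gamma-\rho,\mu,1),\ (a_i,A_i,\alpha_i)_{1,p}\\(b_j,B_j,\beta_j)_{1,q},\ (1-\gamma-\rho,\mu,1),\ (1-\beta-\rho,\mu,1)\end{matrix}\right].$$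
   Context: **$I$-function.** Let $m,n,p,q$ be integers with $0\le m\le q$, $0\le n\le p$; let $a_i\in\mathbb{C}$, $A_i,\alpha_i>0$ $(1\le i\le p)$ and $b_j\in\mathbb{C}$, $B_j,\beta_j>0$ $(1\le j\le q)$. For $z\neq0$ (with a chosen value of $\arg z$; $z^{-s}=e^{-s(\log|z|+i\arg z)}$), $$I^{m,n}_{p,q}\left[z\,\middle|\begin{matrix}(a_i,A_i,\alpha_i)_{1,p}\\(b_j,B_j,\beta_j)_{1,q}\end{matrix}\right]=\frac{1}{2\pi i}\int_{C}\chi(s)z^{-s}\,ds,\qquad \chi(s)=\frac{\prod_{j=1}^{m}\Gamma^{\beta_j}(b_j+B_js)\prod_{i=1}^{n}\Gamma^{\alpha_i}(1-a_i-A_is)}{\prod_{j=m+1}^{q}\Gamma^{\beta_j}(1-b_j-B_js)\prod_{i=n+1}^{p}\Gamma^{\alpha_i}(a_i+A_is)}.$$ Here $(a_i,A_i,\alpha_i)_{1,p}$ is the ordered list of triples for $i=1,\dots,p$ (the first $n$ upper triples and the first $m$ lower triples enter the numerator), $\Gamma^{\kappa}(w)=(\Gamma(w))^{\kappa}$, with the branch of non-integer powers fixed along $C$ and the same for the same triple in all $I$-functions considered; empty products equal $1$. The singularities of $\Gamma^{\beta_j}(b_j+B_js)$, $j\le m$, lie to the left of $C$ and those of $\Gamma^{\alpha_i}(1-a_i-A_is)$, $i\le n$, to the right. **Standing assumptions.** The contour $C$ is the imaginary axis $\operatorname{Re}(s)=0$, traversed upwards, and for each $I$-function occurring the following conditions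 for absolute convergence hold: with (computed from the parameters of that $I$-function) $\mu^*=\sum_{j=1}^q\beta_jB_j-\sum_{i=1}^p\alpha_iA_i$, $\Omega=\sum_{i=1}^p(\frac12-\operatorname{Re}(a_i))\alpha_i-\sum_{j=1}^q(\frac12-\operatorname{Re}(b_j))\beta_j$, $\Delta=\sum_{j=1}^m\beta_jB_j-\sum_{j=m+1}^q\beta_jB_j+\sum_{i=1}^n\alpha_iA_i-\sum_{i=n+1}^p\alpha_iA_i$, either $\Delta>0$ and $|\arg z|<\frac{\pi}{2}\Delta$, or $\Delta\ge0$, $|\arg z|=\frac{\pi}{2}\Delta$ and one of: $\mu^*=0$ and $\Omega<-1$; or $\mu^*\ne0$ and $\Omega+\sigma\mu^*<-1$ where $\sigma=\operatorname{Re}(s)$ on $C$ (so $\sigma=0$). For $t>0$, $\arg(at^{\pm\mu})=\arg a$. **Operators.** For $\operatorname{Re}(\alpha)>0$, $x>0$, the left-sided Saigo fractional integral is $$\left(\mathcal{I}_{0+}^{\alpha,\beta,\gamma}f\right)(x)=\frac{x^{-\alpha-\beta}}{\Gamma(\alpha)}\int_0^x(x-t)^{\alpha-1}{}_{2}F_1\left(\alpha+\beta,-\gamma;\alpha;1-\tfrac{t}{x}\right)f(t)\,dt,$$ and the left-sided Saigo (generalized) fractional derivative is $$\left(\mathcal{D}_{0+}^{\alpha,\beta,\gamma}f\right)(x)=\left(\frac{d}{dx}\right)^{N}\left(\mathcal{I}_{0+}^{-\alpha+N,-\beta-N,\alpha+\gamma-N}f\right)(x),\qquad N=[\operatorname{Re}(\alpha)]+1,$$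 with $[\cdot]$ the integer part. *)

theory Defs
  imports "HOL-Analysis.Analysis"
begin

section \<open>The I-function\<close>

text \<open>
  A triple \<open>(c, C, \<kappa>)\<close> is a parameter \<open>(a\<^sub>i, A\<^sub>i, \<alpha>\<^sub>i)\<close> or \<open>(b\<^sub>j, B\<^sub>j, \<beta>\<^sub>j)\<close>.  The upper and the lower
  parameters are the lists \<open>us\<close> and \<open>ls\<close>, so \<open>p = length us\<close> and \<open>q = length ls\<close>; since list
  indices start at 0, the first \<open>n\<close> upper triples are \<open>us ! i\<close> with \<open>i < n\<close>.
\<close>

type_synonym triple = "complex \<times> real \<times> real"

text \<open>The contour \<open>C\<close> is the line \<open>Re s = contour_abscissa\<close>, i.e. the imaginary axis.\<close>

definition contour_abscissa :: real where
  "contour_abscissa = 0"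

definition contour_line :: "complex set" where
  "contour_line = {s. Re s = contour_abscissa}"

text \<open>
  A choice of branches assigns to each factor \<open>\<Gamma>(c + C s)\<^sup>\<kappa>\<close> a function \<open>L c C \<kappa>\<close> that is a
  logarithm of \<open>\<Gamma>(c + C s)\<close>, continuous along the contour.  The factor of a denominator may have a
  pole on the contour, where no logarithm exists; this point is left out.
  Within one integrand, or in two of them, the factors of two triples can only coincide if the
  triples do (the sign of \<open>C\<close> tells \<open>1 - a - A s\<close> from \<open>b + B s\<close>), so indexing by the factor means
  that a triple always comes with the same branch.
\<close>

type_synonym branches = "complex \<Rightarrow> real \<Rightarrow> real \<Rightarrow> complex \<Rightarrow> complex"

definition Gamma_branches :: "branches \<Rightarrow> bool" where
  "Gamma_branches L \<longleftrightarrow>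
     (\<forall>c C \<kappa>. let S = {s \<in> contour_line. c + of_real C * s \<notin> \<int>\<^sub>\<le>\<^sub>0} in
        continuous_on S (L c C \<kappa>) \<and>
        (\<forall>s\<in>S. exp (L c C \<kappa> s) = Gamma (c + of_real C * s)))"

text \<open>
  The value \<open>0\<close> at a pole makes the reciprocal \<open>0\<close> as well (as \<open>1 / 0 = 0\<close>), which is the
  continuous extension of \<open>1 / \<Gamma>\<^sup>\<kappa>\<close> for \<open>\<kappa> > 0\<close>.
\<close>

definition Gamma_pow :: "branches \<Rightarrow> complex \<Rightarrow> real \<Rightarrow> real \<Rightarrow> complex \<Rightarrow> complex" where
  "Gamma_pow L c C \<kappa> s =
     (if c + of_real C * s \<in> \<int>\<^sub>\<le>\<^sub>0 then 0 else exp (of_real \<kappa> * L c C \<kappa> s))"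

definition I_kernel ::
  "branches \<Rightarrow> nat \<Rightarrow> nat \<Rightarrow> triple list \<Rightarrow> triple list \<Rightarrow> complex \<Rightarrow> complex" where
  "I_kernel L m n us ls s =
     ((\<Prod>j<m. case ls ! j of (b, B, \<kappa>) \<Rightarrow> Gamma_pow L b B \<kappa> s) *
      (\<Prod>i<n. case us ! i of (a, A, \<kappa>) \<Rightarrow> Gamma_pow L (1 - a) (- A) \<kappa> s)) /
     ((\<Prod>j\<in>{m..<length ls}. case ls ! j of (b, B, \<kappa>) \<Rightarrow> Gamma_pow L (1 - b) (- B) \<kappa> s) *
      (\<Prod>i\<in>{n..<length us}. case us ! i of (a, A, \<kappa>) \<Rightarrow> Gamma_pow L a A \<kappa> s))"

text \<open>
  The argument \<open>z\<close> comes with a chosen value \<open>\<theta>\<close> of \<open>arg z\<close> (not necessarily the principal one).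
  The contour is parametrised by \<open>s = contour_abscissa + \<i> \<tau>\<close>, whence \<open>ds = \<i> d\<tau>\<close>.
\<close>

definition is_arg :: "complex \<Rightarrow> real \<Rightarrow> bool" where
  "is_arg z \<theta> \<longleftrightarrow> z = rcis (cmod z) \<theta>"

definition I_function ::
  "branches \<Rightarrow> nat \<Rightarrow> nat \<Rightarrow> triple list \<Rightarrow> triple list \<Rightarrow> complex \<Rightarrow> real \<Rightarrow> complex" where
  "I_function L m n us ls z \<theta> =
     1 / (2 * of_real pi * \<i>) *
     (CLINT \<tau>|lborel.
        (let s = Complex contour_abscissa \<tau> in
           I_kernel L m n us ls s * exp (- s * (of_real (ln (cmod z)) + \<i> * of_real \<theta>)) * \<i>))"

definition I_mu_star :: "triple list \<Rightarrow> triple list \<Rightarrow> real" where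
  "I_mu_star us ls =
     (\<Sum>j<length ls. case ls ! j of (b, B, \<kappa>) \<Rightarrow> \<kappa> * B) -
     (\<Sum>i<length us. case us ! i of (a, A, \<kappa>) \<Rightarrow> \<kappa> * A)"

definition I_Omega :: "triple list \<Rightarrow> triple list \<Rightarrow> real" where
  "I_Omega us ls =
     (\<Sum>i<length us. case us ! i of (a, A, \<kappa>) \<Rightarrow> (1/2 - Re a) * \<kappa>) -
     (\<Sum>j<length ls. case ls ! j of (b, B, \<kappa>) \<Rightarrow> (1/2 - Re b) * \<kappa>)"

definition I_Delta :: "nat \<Rightarrow> nat \<Rightarrow> triple list \<Rightarrow> triple list \<Rightarrow> real" where
  "I_Delta m n us ls =
     (\<Sum>j<m. case ls ! j of (b, B, \<kappa>) \<Rightarrow> \<kappa> * B) -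
     (\<Sum>j\<in>{m..<length ls}. case ls ! j of (b, B, \<kappa>) \<Rightarrow> \<kappa> * B) +
     (\<Sum>i<n. case us ! i of (a, A, \<kappa>) \<Rightarrow> \<kappa> * A) -
     (\<Sum>i\<in>{n..<length us}. case us ! i of (a, A, \<kappa>) \<Rightarrow> \<kappa> * A)"

definition I_abs_conv :: "nat \<Rightarrow> nat \<Rightarrow> triple list \<Rightarrow> triple list \<Rightarrow> real \<Rightarrow> bool" where
  "I_abs_conv m n us ls \<theta> \<longleftrightarrow>
     (let \<Delta> = I_Delta m n us ls; \<Omega> = I_Omega us ls; \<mu> = I_mu_star us ls in
        (\<Delta> > 0 \<and> \<bar>\<theta>\<bar> < pi / 2 * \<Delta>) \<or>
        (\<Delta> \<ge> 0 \<and> \<bar>\<theta>\<bar> = pi / 2 * \<Delta> \<and>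
           (\<mu> = 0 \<and> \<Omega> < -1 \<or> \<mu> \<noteq> 0 \<and> \<Omega> + contour_abscissa * \<mu> < -1)))"

text \<open>The last two conjuncts: the contour separates the singularities of the numerator.\<close>

definition I_params :: "nat \<Rightarrow> nat \<Rightarrow> triple list \<Rightarrow> triple list \<Rightarrow> bool" where
  "I_params m n us ls \<longleftrightarrow>
     m \<le> length ls \<and> n \<le> length us \<and>
     (\<forall>(a, A, \<kappa>)\<in>set us. A > 0 \<and> \<kappa> > 0) \<and>
     (\<forall>(b, B, \<kappa>)\<in>set ls. B > 0 \<and> \<kappa> > 0) \<and>
     (\<forall>j<m. case ls ! j of (b, B, \<kappa>) \<Rightarrow>
        \<forall>s. b + of_real B * s \<in> \<int>\<^sub>\<le>\<^sub>0 \<longrightarrow> Re s < contour_abscissa) \<and>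
     (\<forall>i<n. case us ! i of (a, A, \<kappa>) \<Rightarrow>
        \<forall>s. 1 - a - of_real A * s \<in> \<int>\<^sub>\<le>\<^sub>0 \<longrightarrow> Re s > contour_abscissa)"

section \<open>Saigo fractional integral and derivative\<close>

text \<open>The Gauss series; below it is only used at arguments in the interval \<open>(0, 1)\<close>.\<close>

definition hyp2F1 :: "complex \<Rightarrow> complex \<Rightarrow> complex \<Rightarrow> complex \<Rightarrow> complex" where
  "hyp2F1 a b c z = eval_fps (fps_hypergeo [a, b] [c] 1) z"

definition saigo_integrand ::
  "complex \<Rightarrow> complex \<Rightarrow> complex \<Rightarrow> (real \<Rightarrow> complex) \<Rightarrow> real \<Rightarrow> real \<Rightarrow> complex" where
  "saigo_integrand \<alpha> \<beta> \<gamma> f x t =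
     of_real (x - t) powr (\<alpha> - 1) *
     hyp2F1 (\<alpha> + \<beta>) (- \<gamma>) \<alpha> (of_real (1 - t / x)) * f t"

definition saigo_integral ::
  "complex \<Rightarrow> complex \<Rightarrow> complex \<Rightarrow> (real \<Rightarrow> complex) \<Rightarrow> real \<Rightarrow> complex" where
  "saigo_integral \<alpha> \<beta> \<gamma> f x =
     of_real x powr (- \<alpha> - \<beta>) / Gamma \<alpha> *
     (CLINT t:{0<..<x}|lborel. saigo_integrand \<alpha> \<beta> \<gamma> f x t)"

definition saigo_order :: "complex \<Rightarrow> nat" where
  "saigo_order \<alpha> = nat \<lfloor>Re \<alpha>\<rfloor> + 1"

definition iter_deriv :: "nat \<Rightarrow> (real \<Rightarrow> complex) \<Rightarrow> real \<Rightarrow> complex" where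
  "iter_deriv k = (\<lambda>g x. vector_derivative g (at x)) ^^ k"

definition saigo_derivative ::
  "complex \<Rightarrow> complex \<Rightarrow> complex \<Rightarrow> (real \<Rightarrow> complex) \<Rightarrow> real \<Rightarrow> complex" where
  "saigo_derivative \<alpha> \<beta> \<gamma> f =
     (let N = saigo_order \<alpha> in
        iter_deriv N
          (saigo_integral (- \<alpha> + of_nat N) (- \<beta> - of_nat N) (\<alpha> + \<gamma> - of_nat N) f))"

text \<open>
  The integral and the derivatives above are total functions with arbitrary values where they do not
  exist; the following says that the derivative is meaningful on the positive half-line.
\<close>

definition saigo_derivative_exists ::
  "complex \<Rightarrow> complex \<Rightarrow> complex \<Rightarrow> (real \<Rightarrow> complex) \<Rightarrow> bool" where
  "saigo_derivative_exists \<alpha> \<beta> \<gamma> f \<longleftrightarrow>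
     (let N = saigo_order \<alpha>;
          \<alpha>' = - \<alpha> + of_nat N; \<beta>' = - \<beta> - of_nat N; \<gamma>' = \<alpha> + \<gamma> - of_nat N
      in \<forall>x>0. set_integrable lborel {0<..<x} (saigo_integrand \<alpha>' \<beta>' \<gamma>' f x) \<and>
               (\<forall>k<N. iter_deriv k (saigo_integral \<alpha>' \<beta>' \<gamma>' f) differentiable (at x)))"

end

theory Submission
  imports Defs "HOL-Real_Asymp.Real_Asymp"
begin

text \<open>
  The Saigo integral maps a power to a power: with \<open>\<sigma> = \<rho> - \<mu> s\<close>,
  \<open>\<I>\<^bsup>\<alpha>,\<beta>,\<gamma>\<^esup> t\<^bsup>\<sigma>-1\<^esup> = \<Gamma>(\<sigma>) \<Gamma>(\<sigma>+\<gamma>-\<beta>) / (\<Gamma>(\<sigma>-\<beta>) \<Gamma>(\<sigma>+\<alpha>+\<gamma>)) x\<^bsup>\<sigma>-\<beta>-1\<^esup>\<close>.  The function to be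
  differentiated is a superposition of such powers, weighted by the kernel \<open>\<chi>(s)\<close>.  The parameters
  \<open>N - \<alpha>, - \<beta> - N, \<alpha> + \<gamma> - N\<close> occurring in the derivative turn the multiplier into
  \<open>\<Gamma>(\<sigma>) \<Gamma>(\<sigma>+\<alpha>+\<beta>+\<gamma>) / (\<Gamma>(\<sigma>+\<beta>+N) \<Gamma>(\<sigma>+\<gamma>))\<close>, and the \<open>N\<close> outer derivatives multiply it by
  \<open>(\<sigma>+\<beta>)(\<sigma>+\<beta>+1)\<cdots>(\<sigma>+\<beta>+N-1)\<close>, which replaces \<open>\<Gamma>(\<sigma>+\<beta>+N)\<close> by \<open>\<Gamma>(\<sigma>+\<beta>)\<close>.  The four Gamma factors that
  remain are the ones contributed by the four new triples (\<open>I_kernel_extend\<close>).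

  \<^bold>\<open>The power rule.\<close>  Integrating the Gauss series termwise against \<open>u\<^bsup>\<alpha>-1\<^esup> (1-u)\<^bsup>\<sigma>-1\<^esup>\<close> turns
  \<open>\<^sub>2F\<^sub>1(\<cdot>,\<cdot>;\<alpha>;u)\<close> into \<open>\<^sub>2F\<^sub>1(\<cdot>,\<cdot>;\<alpha>+\<sigma>;1)\<close>, which Gauss's theorem evaluates
  (\<open>gauss_summation\<close>, \<open>hypergeometric_Beta_integral\<close>).  Gauss's theorem also supplies the Beta integral
  for complex parameters.

  \<^bold>\<open>Interchange with the contour integral.\<close>  On the contour \<open>\<bar>t\<^bsup>-\<mu> s\<^esup>\<bar> = 1\<close>, so Fubini's theorem
  asks only for the absolute convergence in the power rule and for the integrability of \<open>\<chi>\<close> along the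
  contour (\<open>saigo_integral_mellin_integral\<close>).

  \<^bold>\<open>Differentiation under the integral sign.\<close>  Each derivative costs one more power of \<open>s\<close>.  After \<open>N\<close>
  steps the integrand is that of the \<open>I\<close>-function on the right-hand side, and the integrability of this
  one together with that of the original one controls all the steps in between
  (\<open>integrable_partial_product\<close>).

  \<^bold>\<open>Integrability of the kernel.\<close>  Stirling's estimate for \<open>\<bar>\<Gamma>(a + \<i> y)\<bar>\<close> (\<open>ln_norm_Gamma_bound\<close>) shows that
  on the contour \<open>\<chi>(\<i> \<tau>) = O((1 + \<bar>\<tau>\<bar>)\<^bsup>\<Omega>\<^esup> exp(- \<pi> \<Delta> \<bar>\<tau>\<bar> / 2))\<close>, and the conditions on \<open>\<Delta>\<close>, \<open>\<Omega>\<close> and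
  \<open>arg z\<close> say that this, multiplied by \<open>exp(\<theta> \<tau>)\<close>, is integrable (\<open>integrable_I_kernel\<close>).
\<close>

section \<open>The modulus of the Gamma function on vertical lines\<close>

text \<open>
  On the line \<open>Re z = 1/2\<close> the reflection \<open>z \<mapsto> 1 - z\<close> is complex conjugation, so the reflection formula
  yields the modulus of \<open>\<Gamma>\<close> exactly.  All other vertical lines are compared with this one.
\<close>
lemma norm_Gamma_critical_line:
  "cmod (Gamma (Complex (1/2) y)) ^ 2 = pi / cosh (pi * y)"
proof -
  define z where "z = Complex (1/2) y"
  have c: "1 - z = cnj z" by (simp add: z_def complex_eq_iff)
  have "sin (of_real pi * z) = sin (of_real (pi / 2) + \<i> * of_real (pi * y))"
    by (rule arg_cong[where f = sin]) (simp add: z_def complex_eq_iff)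
  also have "\<dots> = cos (\<i> * of_real (pi * y))"
    by (simp add: sin_add sin_of_real cos_of_real del: of_real_mult of_real_divide)
  also have "\<dots> = of_real (cosh (pi * y))"
    by (simp add: cosh_conv_cos cosh_def cos_exp_eq exp_of_real flip: exp_minus)
       (simp add: scaleR_conv_of_real exp_of_real[symmetric])
  finally have s: "sin (of_real pi * z) = of_real (cosh (pi * y))" .
  have "of_real (cmod (Gamma z) ^ 2) = Gamma z * Gamma (1 - z)"
    unfolding c by (metis cnj_Gamma complex_norm_square)
  also have "\<dots> = of_real (pi / cosh (pi * y))"
    using Gamma_reflection_complex[of z] s by simp
  finally show ?thesis unfolding z_def of_real_eq_iff .
qed

lemma ln_norm_Gamma_critical_line:
  "\<bar>ln (cmod (Gamma (Complex (1/2) y))) + pi / 2 * \<bar>y\<bar>\<bar> \<le> ln (2 * pi)"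
proof -
  define g where "g = cmod (Gamma (Complex (1/2) y))"
  have g2: "g ^ 2 = pi / cosh (pi * y)" unfolding g_def by (rule norm_Gamma_critical_line)
  have c0: "cosh (pi * y) > 0" by (rule cosh_real_pos)
  have g0: "g > 0"
    using g2 c0 by (smt (verit) g_def divide_pos_pos norm_ge_zero pi_gt_zero power_zero_numeral)
  have "2 * ln g = ln (g ^ 2)" using g0 by (simp add: ln_realpow)
  also have "\<dots> = ln pi - ln (cosh (pi * y))" using c0 by (simp add: g2 ln_div)
  finally have lg: "2 * ln g = ln pi - ln (cosh (pi * y))" .
  have ce: "cosh (pi * y) = (exp (pi * \<bar>y\<bar>) + exp (- (pi * \<bar>y\<bar>))) / 2"
    by (simp add: cosh_def abs_if)
  have "exp (pi * \<bar>y\<bar>) / 2 \<le> cosh (pi * y)" "cosh (pi * y) \<le> exp (pi * \<bar>y\<bar>)"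
    unfolding ce by auto
  hence "ln (exp (pi * \<bar>y\<bar>) / 2) \<le> ln (cosh (pi * y))" "ln (cosh (pi * y)) \<le> ln (exp (pi * \<bar>y\<bar>))"
    using c0 by (subst ln_le_cancel_iff; simp)+
  hence l: "pi * \<bar>y\<bar> - ln 2 \<le> ln (cosh (pi * y))" "ln (cosh (pi * y)) \<le> pi * \<bar>y\<bar>"
    by (simp_all add: ln_div)
  have "ln pi \<ge> 0" "ln (2::real) \<ge> 0" "ln (2 * pi) = ln 2 + ln pi"
    using pi_ge_two by (auto simp: ln_mult)
  thus ?thesis unfolding g_def[symmetric] using lg l unfolding abs_le_iff by (intro conjI; linarith)
qed

text \<open>
  \<open>u / (u\<^sup>2 + y\<^sup>2)\<close> is \<open>Re (1 / (u + \<i> y))\<close>, and its primitive is \<open>ln (u\<^sup>2 + y\<^sup>2) / 2\<close>.  So this compares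
  one term of \<open>\<Sum>n. Re (1 / (z + n))\<close> with the integral over the corresponding unit interval; the
  error is summable over \<open>u = a + n\<close>, uniformly in \<open>y\<close>.
\<close>
lemma Re_inverse_telescope:
  fixes u y :: real
  assumes "u > 0" "\<bar>y\<bar> \<ge> 1"
  shows "\<bar>u / (u^2 + y^2) - (ln ((u+1)^2 + y^2) / 2 - ln (u^2 + y^2) / 2)\<bar> \<le> 1 / (u^2 + 1)"
proof -
  have y2: "y^2 \<ge> 1" using assms by (metis one_le_power power2_abs)
  have "\<exists>z>u. z < u + 1 \<and> ln ((u+1)^2 + y^2) / 2 - ln (u^2 + y^2) / 2 = (u + 1 - u) * (z / (z^2 + y^2))"
  proof (rule MVT2)
    fix x
    have "x^2 + y^2 > 0" using y2 by (auto intro!: add_nonneg_pos)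
    thus "((\<lambda>x. ln (x^2 + y^2) / 2) has_real_derivative x / (x^2 + y^2)) (at x)"
      by (auto intro!: derivative_eq_intros simp: divide_simps)
  qed simp
  then obtain z where z: "u < z" "z < u + 1"
    and eq: "ln ((u+1)^2 + y^2) / 2 - ln (u^2 + y^2) / 2 = z / (z^2 + y^2)" by auto
  have p: "u^2 + y^2 > 0" "z^2 + y^2 > 0" using y2 by (auto intro!: add_nonneg_pos)
  have "u / (u^2 + y^2) - z / (z^2 + y^2) = (z - u) * (u * z - y^2) / ((u^2+y^2) * (z^2+y^2))"
    using p by (subst diff_frac_eq) (auto simp: algebra_simps power2_eq_square)
  hence "\<bar>u / (u^2 + y^2) - z / (z^2 + y^2)\<bar> = (z - u) * \<bar>u * z - y^2\<bar> / ((u^2+y^2) * (z^2+y^2))"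
    using p z by (simp add: abs_mult)
  also have "\<dots> \<le> 1 * (z^2 + y^2) / ((u^2+y^2) * (z^2+y^2))"
  proof (intro divide_right_mono mult_mono)
    have "0 \<le> u * z" "u * z \<le> z^2" using assms z by (auto simp: power2_eq_square intro: mult_right_mono)
    thus "\<bar>u * z - y^2\<bar> \<le> z^2 + y^2" using y2 by (simp add: abs_le_iff)
  qed (use z p in auto)
  also have "\<dots> = 1 / (u^2 + y^2)" using p by (simp only: mult_1_left nonzero_divide_mult_cancel_right)
  also have "\<dots> \<le> 1 / (u^2 + 1)"
    using y2 p by (intro divide_left_mono mult_pos_pos) (auto intro: add_nonneg_pos)
  finally show ?thesis by (simp add: eq)
qed

text \<open>
  \<open>Digamma z\<close> is the limit of \<open>ln m - (\<Sum>n<m. 1 / (z + n))\<close>.  Replacing the real part of the sum by the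
  telescoping sum above costs at most a constant and leaves \<open>ln \<bar>z\<bar>\<close>, which differs from \<open>ln \<bar>y\<bar>\<close> by at
  most \<open>a\<^sup>2\<close>.
\<close>
lemma Re_Digamma_bound:
  "\<exists>S. \<forall>a y. 0 < a \<longrightarrow> 1 \<le> \<bar>y\<bar> \<longrightarrow> \<bar>Re (Digamma (Complex a y)) - ln \<bar>y\<bar>\<bar> \<le> S + a^2"
proof -
  define S where "S = (\<Sum>k. 1 / ((real k)^2 + 1))"
  have summ: "summable (\<lambda>k. 1 / ((real k)^2 + 1))"
  proof (rule summable_comparison_test_ev)
    show "summable (\<lambda>k. 1 / (real k)^2)"
      using inverse_power_summable[of 2, where 'a = real] by (simp add: inverse_eq_divide)
    show "\<forall>\<^sub>F k in sequentially. norm (1 / ((real k)^2 + 1)) \<le> 1 / (real k)^2"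
      using eventually_gt_at_top[of 0]
      by eventually_elim (auto intro!: divide_left_mono mult_pos_pos add_nonneg_pos)
  qed
  have "\<bar>Re (Digamma (Complex a y)) - ln \<bar>y\<bar>\<bar> \<le> S + a^2" if a: "0 < a" and y: "1 \<le> \<bar>y\<bar>" for a y
  proof -
    define z where "z = Complex a y"
    define H where "H = (\<lambda>u. ln (u^2 + y^2) / 2)"
    define h where "h = (\<lambda>u. u / (u^2 + y^2))"
    have y2: "y^2 \<ge> 1" using y by (metis one_le_power power2_abs)
    have z0: "z \<noteq> 0" using a by (auto simp: z_def complex_eq_iff)
    have "Re (of_real (ln (real m)) - (\<Sum>n<m. inverse (z + of_nat n))) = ln (real m) - (\<Sum>n<m. h (a +
        real n))" for m
      by (simp add: z_def h_def)
    with tendsto_Re[OF Digamma_LIMSEQ[OF z0]]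
    have L: "(\<lambda>m. ln (real m) - (\<Sum>n<m. h (a + real n))) \<longlonglongrightarrow> Re (Digamma z)" by simp
    have "(\<lambda>m. ln (real m) - ln ((a + real m)^2 + y^2) / 2) \<longlonglongrightarrow> 0"
      by real_asymp
    hence "(\<lambda>m. (ln (real m) - ln ((a + real m)^2 + y^2) / 2) + H a) \<longlonglongrightarrow> 0 + H a"
      by (intro tendsto_intros)
    hence L2: "(\<lambda>m. ln (real m) - (H (a + real m) - H a)) \<longlonglongrightarrow> H a" by (simp add: H_def algebra_simps)
    have "\<bar>(ln (real m) - (\<Sum>n<m. h (a + real n))) - (ln (real m) - (H (a + real m) - H a))\<bar> \<le> S" for m
    proof -
      have "H (a + real m) - H a = (\<Sum>n<m. H (a + real (Suc n)) - H (a + real n))"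
        by (subst sum_lessThan_telescope) simp
      hence "\<bar>(ln (real m) - (\<Sum>n<m. h (a + real n))) - (ln (real m) - (H (a + real m) - H a))\<bar>
          = \<bar>\<Sum>n<m. h (a + real n) - (H (a + real (Suc n)) - H (a + real n))\<bar>"
        by (simp add: sum_subtractf)
      also have "\<dots> \<le> (\<Sum>n<m. \<bar>h (a + real n) - (H (a + real (Suc n)) - H (a + real n))\<bar>)" by (rule sum_abs)
      also have "\<dots> \<le> (\<Sum>n<m. 1 / ((real n)^2 + 1))"
      proof (rule sum_mono)
        fix n
        have "\<bar>h (a + real n) - (H (a + real (Suc n)) - H (a + real n))\<bar> \<le> 1 / ((a + real n)^2 + 1)"
          using Re_inverse_telescope[of "a + n" y] a y by (simp add: h_def H_def algebra_simps)
        also have "\<dots> \<le> 1 / ((real n)^2 + 1)"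
          using a by (intro divide_left_mono mult_pos_pos add_right_mono power_mono) (auto intro:
              add_nonneg_pos)
        finally show "\<bar>h (a + real n) - (H (a + real (Suc n)) - H (a + real n))\<bar> \<le> 1 / ((real n)^2 + 1)" .
      qed
      also have "\<dots> \<le> S" unfolding S_def by (rule sum_le_suminf[OF summ]) auto
      finally show ?thesis .
    qed
    hence "\<bar>Re (Digamma z) - H a\<bar> \<le> S"
      using tendsto_rabs[OF tendsto_diff[OF L L2]] by (intro tendsto_upperbound) auto
    moreover have "\<bar>H a - ln \<bar>y\<bar>\<bar> \<le> a^2"
    proof -
      have "y^2 \<noteq> 0" using y2 by linarith
      hence "a^2 + y^2 = y^2 * (1 + a^2 / y^2)"
          by (simp add: distrib_left del: power_eq_0_iff zero_eq_power2)
      hence "ln (a^2 + y^2) = ln (y^2) + ln (1 + a^2 / y^2)"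
        using y2 by (simp only:) (subst ln_mult_pos, auto intro: add_pos_nonneg)
      also have "ln (y^2) = 2 * ln \<bar>y\<bar>" using y
          by (metis ln_realpow abs_1 less_numeral_extra(1) order_less_le_trans power2_abs of_nat_numeral)
      finally have "H a - ln \<bar>y\<bar> = ln (1 + a^2 / y^2) / 2"
        by (simp only: H_def add_divide_distrib)
      moreover have "ln (1 + a^2 / y^2) \<ge> 0" by simp
      moreover have "ln (1 + a^2 / y^2) \<le> a^2 / y^2" by (rule ln_add_one_self_le_self) simp
      moreover have "a^2 / y^2 \<le> a^2" using y2
          by (simp add: divide_simps mult_le_cancel_left1 split: if_splits)
      ultimately show ?thesis by linarith
    qed
    ultimately show ?thesis unfolding z_def by linarith
  qed
  thus ?thesis by blast
qed

text \<open>
  The derivative of \<open>Re (ln_Gamma (t + \<i> y)) - t ln \<bar>y\<bar>\<close> in \<open>t\<close> is \<open>Re (Digamma (t + \<i> y)) - ln \<bar>y\<bar>\<close>, hence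
  bounded uniformly in \<open>y\<close>.  The mean value theorem carries the estimate from the line \<open>t = 1/2\<close> to
  the line \<open>t = a\<close>.
\<close>
lemma ln_norm_Gamma_bound_pos:
  assumes a: "a > 0"
  shows "\<exists>M. \<forall>y. 1 \<le> \<bar>y\<bar> \<longrightarrow>
           \<bar>ln (cmod (Gamma (Complex a y))) - ((a - 1/2) * ln \<bar>y\<bar> - pi / 2 * \<bar>y\<bar>)\<bar> \<le> M"
proof -
  obtain S where S: "\<And>t y. 0 < t \<Longrightarrow> 1 \<le> \<bar>y\<bar> \<Longrightarrow> \<bar>Re (Digamma (Complex t y)) - ln \<bar>y\<bar>\<bar> \<le> S + t^2"
    using Re_Digamma_bound by blast
  define A where "A = max a (1/2)"
  define C where "C = S + A^2"
  have "\<bar>ln (cmod (Gamma (Complex a y))) - ((a - 1/2) * ln \<bar>y\<bar> - pi / 2 * \<bar>y\<bar>)\<bar>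
          \<le> ln (2 * pi) + C * \<bar>a - 1/2\<bar>" if y: "1 \<le> \<bar>y\<bar>" for y
  proof -
    define \<phi> where "\<phi> = (\<lambda>t. Re (ln_Gamma (of_real t + \<i> * of_real y)) - t * ln \<bar>y\<bar>)"
    have nr: "of_real t + \<i> * of_real y \<notin> \<real>\<^sub>\<le>\<^sub>0" for t
      using y by (auto simp: complex_nonpos_Reals_iff)
    have d: "(\<phi> has_real_derivative (Re (Digamma (Complex t y)) - ln \<bar>y\<bar>)) (at t within X)" for t X
    proof -
      have "((\<lambda>t. ln_Gamma (of_real t + \<i> * of_real y)) has_vector_derivative
               (1 * Digamma (of_real t + \<i> * of_real y))) (at t within X)"
        by (rule field_vector_diff_chain_at[where g = ln_Gamma and f = "\<lambda>t. of_real t + \<i> * of_real y",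
            unfolded o_def, THEN has_vector_derivative_at_within])
           (use nr in \<open>auto intro!: derivative_eq_intros\<close>)
      from bounded_linear.has_vector_derivative[OF bounded_linear_Re this]
      have "((\<lambda>t. Re (ln_Gamma (of_real t + \<i> * of_real y))) has_real_derivative
               Re (Digamma (Complex t y))) (at t within X)"
        unfolding has_real_derivative_iff_has_vector_derivative Complex_eq by (simp only: mult_1_left)
      moreover have "((\<lambda>t. t * ln \<bar>y\<bar>) has_real_derivative ln \<bar>y\<bar>) (at t within X)"
        by (auto intro!: derivative_eq_intros)
      ultimately show ?thesis unfolding \<phi>_def by (rule DERIV_diff)
    qed
    have "norm (\<phi> a - \<phi> (1/2)) \<le> C * norm (a - 1/2)"
    proof (rule field_differentiable_bound[OF _ d])
      show "convex {t. 0 < t \<and> t \<le> A}"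
        using convex_real_interval(6)[of 0 A]
            by (simp add: greaterThanAtMost_def greaterThan_def atMost_def Collect_conj_eq)
      fix t assume t: "t \<in> {t. 0 < t \<and> t \<le> A}"
      have "\<bar>Re (Digamma (Complex t y)) - ln \<bar>y\<bar>\<bar> \<le> S + t^2" using S t y by auto
      also have "\<dots> \<le> C" unfolding C_def using t by (intro add_left_mono power_mono) auto
      finally show "norm (Re (Digamma (Complex t y)) - ln \<bar>y\<bar>) \<le> C" by simp
    qed (use a in \<open>auto simp: A_def\<close>)
    moreover have "ln (cmod (Gamma (Complex t y))) = \<phi> t + t * ln \<bar>y\<bar>" for t
    proof -
      have "of_real t + \<i> * of_real y \<notin> \<int>\<^sub>\<le>\<^sub>0" using nr[of t] nonpos_Ints_subset_nonpos_Reals by blast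
      hence "Gamma (Complex t y) = exp (ln_Gamma (of_real t + \<i> * of_real y))"
        by (simp add: Complex_eq Gamma_complex_altdef)
      thus ?thesis by (simp add: \<phi>_def)
    qed
    ultimately show ?thesis using ln_norm_Gamma_critical_line[of y]
      by (simp add: abs_le_iff algebra_simps)
  qed
  thus ?thesis by blast
qed

text \<open>
  Stirling's estimate, up to constants: \<open>\<bar>\<Gamma>(a + \<i> y)\<bar>\<close> is of the exact order
  \<open>\<bar>y\<bar>\<^bsup>a-1/2\<^esup> exp(- \<pi> \<bar>y\<bar> / 2)\<close>.  From \<open>a > 0\<close> it extends to the left one unit at a time by
  \<open>\<Gamma>(z + 1) = z \<Gamma>(z)\<close>, as \<open>ln \<bar>a + \<i> y\<bar> = ln \<bar>y\<bar> + O(1)\<close>.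
\<close>
lemma ln_norm_Gamma_bound:
  "\<exists>M. \<forall>y. 1 \<le> \<bar>y\<bar> \<longrightarrow>
     \<bar>ln (cmod (Gamma (Complex a y))) - ((a - 1/2) * ln \<bar>y\<bar> - pi / 2 * \<bar>y\<bar>)\<bar> \<le> M"
proof (induction "nat \<lceil>1 - a\<rceil>" arbitrary: a)
  case 0
  hence "a > 0" by linarith
  thus ?case by (rule ln_norm_Gamma_bound_pos)
next
  case (Suc k)
  have "k = nat \<lceil>1 - (a + 1)\<rceil>" using Suc(2) by linarith
  from Suc(1)[OF this] obtain M where M: "\<And>y. 1 \<le> \<bar>y\<bar> \<Longrightarrow>
     \<bar>ln (cmod (Gamma (Complex (a + 1) y))) - ((a + 1 - 1/2) * ln \<bar>y\<bar> - pi / 2 * \<bar>y\<bar>)\<bar> \<le> M" by blast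
  have "\<bar>ln (cmod (Gamma (Complex a y))) - ((a - 1/2) * ln \<bar>y\<bar> - pi / 2 * \<bar>y\<bar>)\<bar> \<le> M + ln (1 + \<bar>a\<bar>)"
    if y: "1 \<le> \<bar>y\<bar>" for y
  proof -
    have n: "Complex a y \<notin> \<int>\<^sub>\<le>\<^sub>0" using y by (auto elim!: nonpos_Ints_cases simp: complex_eq_iff)
    have "Gamma (Complex (a + 1) y) = Complex a y * Gamma (Complex a y)"
      using Gamma_plus1[OF n] by (simp add: Complex_eq add_ac)
    moreover have "Gamma (Complex a y) \<noteq> 0" using n by (simp add: Gamma_eq_zero_iff)
    moreover have "Complex a y \<noteq> 0" using y by (auto simp: complex_eq_iff)
    ultimately have "ln (cmod (Gamma (Complex (a + 1) y))) =
        ln (cmod (Complex a y)) + ln (cmod (Gamma (Complex a y)))"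
      by (simp add: norm_mult ln_mult)
    moreover have "ln \<bar>y\<bar> \<le> ln (cmod (Complex a y))"
      using y abs_Im_le_cmod[of "Complex a y"] by (subst ln_le_cancel_iff) auto
    moreover have "ln (cmod (Complex a y)) \<le> ln (1 + \<bar>a\<bar>) + ln \<bar>y\<bar>"
    proof -
      have "cmod (Complex a y) \<le> \<bar>a\<bar> + \<bar>y\<bar>" using cmod_le[of "Complex a y"] by simp
      also have "\<dots> \<le> (1 + \<bar>a\<bar>) * \<bar>y\<bar>"
        using mult_left_mono[OF y, of "\<bar>a\<bar>"] by (simp add: algebra_simps)
      finally have "ln (cmod (Complex a y)) \<le> ln ((1 + \<bar>a\<bar>) * \<bar>y\<bar>)"
        using \<open>Complex a y \<noteq> 0\<close> y by (subst ln_le_cancel_iff) auto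
      thus ?thesis using y by (subst (asm) ln_mult_pos) auto
    qed
    moreover have "ln (1 + \<bar>a\<bar>) \<ge> 0" by simp
    ultimately show ?thesis using M[OF y] by (simp add: abs_le_iff algebra_simps)
  qed
  thus ?case by blast
qed

section \<open>Power-exponential growth\<close>

text \<open>
  Both the exponent \<open>e\<close> and the rate \<open>d\<close> are additive under products and scale under powers, so
  those of the kernel of an \<open>I\<close>-function can be read off from its factors.
\<close>
definition growth_bound :: "(real \<Rightarrow> complex) \<Rightarrow> real \<Rightarrow> real \<Rightarrow> bool" where
  "growth_bound F e d \<longleftrightarrow> (\<exists>M. \<forall>\<tau>. cmod (F \<tau>) \<le> M * ((1 + \<bar>\<tau>\<bar>) powr e * exp (- d * \<bar>\<tau>\<bar>)))"

lemma growth_boundE: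
  assumes "growth_bound F e d"
  obtains M where "M \<ge> 0" "\<And>\<tau>. cmod (F \<tau>) \<le> M * ((1 + \<bar>\<tau>\<bar>) powr e * exp (- d * \<bar>\<tau>\<bar>))"
proof -
  from assms obtain M where M: "\<And>\<tau>. cmod (F \<tau>) \<le> M * ((1 + \<bar>\<tau>\<bar>) powr e * exp (- d * \<bar>\<tau>\<bar>))"
    unfolding growth_bound_def by blast
  have "0 \<le> cmod (F 0)" by simp
  also have "\<dots> \<le> M" using M[of 0] by simp
  finally show ?thesis using M that by blast
qed

lemma growth_bound_const: "growth_bound (\<lambda>_. c) 0 0"
  unfolding growth_bound_def by (intro exI[of _ "cmod c"]) auto

lemma growth_bound_mult:
  assumes "growth_bound F e d" "growth_bound G e' d'"
  shows "growth_bound (\<lambda>\<tau>. F \<tau> * G \<tau>) (e + e') (d + d')"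
proof -
  from assms(1) obtain M where M: "M \<ge> 0" "\<And>\<tau>. cmod (F \<tau>) \<le> M * ((1 + \<bar>\<tau>\<bar>) powr e * exp (- d * \<bar>\<tau>\<bar>))"
    by (erule growth_boundE)
  from assms(2) obtain M' where M': "M' \<ge> 0" "\<And>\<tau>. cmod (G \<tau>) \<le> M' * ((1 + \<bar>\<tau>\<bar>) powr e' * exp (- d' * \<bar>\<tau>\<bar>))"
    by (erule growth_boundE)
  have "cmod (F \<tau> * G \<tau>) \<le> (M * M') * ((1 + \<bar>\<tau>\<bar>) powr (e + e') * exp (- (d + d') * \<bar>\<tau>\<bar>))" for \<tau>
  proof -
    have "cmod (F \<tau> * G \<tau>) \<le> (M * ((1 + \<bar>\<tau>\<bar>) powr e * exp (- d * \<bar>\<tau>\<bar>))) * (M' * ((1 + \<bar>\<tau>\<bar>) powr e' *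
        exp (- d' * \<bar>\<tau>\<bar>)))"
      unfolding norm_mult using M M' by (intro mult_mono) auto
    also have "\<dots> = (M * M') * ((1 + \<bar>\<tau>\<bar>) powr (e + e') * exp (- (d + d') * \<bar>\<tau>\<bar>))"
      by (simp add: powr_add exp_add[symmetric] algebra_simps)
    finally show ?thesis .
  qed
  thus ?thesis unfolding growth_bound_def by blast
qed

lemma growth_bound_prod:
  assumes "finite S" "\<And>i. i \<in> S \<Longrightarrow> growth_bound (F i) (e i) (d i)"
  shows "growth_bound (\<lambda>\<tau>. \<Prod>i\<in>S. F i \<tau>) (\<Sum>i\<in>S. e i) (\<Sum>i\<in>S. d i)"
  using assms by (induction S) (auto intro!: growth_bound_const growth_bound_mult)

lemma growth_bound_powr:
  assumes "growth_bound F e d" "\<kappa> > 0" "\<And>\<tau>. cmod (G \<tau>) \<le> cmod (F \<tau>) powr \<kappa>"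
  shows "growth_bound G (\<kappa> * e) (\<kappa> * d)"
proof -
  from assms(1) obtain M where M: "M \<ge> 0" "\<And>\<tau>. cmod (F \<tau>) \<le> M * ((1 + \<bar>\<tau>\<bar>) powr e * exp (- d * \<bar>\<tau>\<bar>))"
    by (erule growth_boundE)
  have "cmod (G \<tau>) \<le> M powr \<kappa> * ((1 + \<bar>\<tau>\<bar>) powr (\<kappa> * e) * exp (- (\<kappa> * d) * \<bar>\<tau>\<bar>))" for \<tau>
  proof -
    have "cmod (G \<tau>) \<le> (M * ((1 + \<bar>\<tau>\<bar>) powr e * exp (- d * \<bar>\<tau>\<bar>))) powr \<kappa>"
      using assms(2,3) M by (meson less_imp_le norm_ge_zero order_trans powr_mono2)
    also have "\<dots> = M powr \<kappa> * ((1 + \<bar>\<tau>\<bar>) powr (\<kappa> * e) * exp (- (\<kappa> * d) * \<bar>\<tau>\<bar>))"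
      using M(1) by (simp add: powr_mult powr_powr exp_powr_real mult_ac)
    finally show ?thesis .
  qed
  thus ?thesis unfolding growth_bound_def by blast
qed

text \<open>
  The absolute value of the exponent lets one constant serve for both signs of \<open>e\<close>.
\<close>
lemma powr_le_of_comparable:
  fixes u v K e :: real
  assumes "0 < u" "0 < v" "u \<le> K * v" "v \<le> K * u"
  shows "u powr e \<le> K powr \<bar>e\<bar> * v powr e"
proof -
  have "0 < K * v" using assms by linarith
  hence K: "K > 0" using assms by (simp add: zero_less_mult_iff)
  show ?thesis
  proof (cases "e \<ge> 0")
    case True
    have "u powr e \<le> (K * v) powr e" using assms True by (intro powr_mono2) auto
    thus ?thesis using True assms K by (simp add: powr_mult)
  next
    case False
    have "(K * u) powr e \<le> v powr e" using assms False by (intro powr_mono2') auto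
    hence "K powr (- e) * (K powr e * u powr e) \<le> K powr (- e) * v powr e"
      using assms K by (intro mult_left_mono) (auto simp: powr_mult)
    thus ?thesis using False K by (simp add: powr_add[symmetric] flip: mult.assoc)
  qed
qed

lemma growth_bound_affine:
  assumes "growth_bound F e d" "C \<noteq> 0"
  shows "growth_bound (\<lambda>\<tau>. F (y0 + C * \<tau>)) e (\<bar>C\<bar> * d)"
proof -
  from assms(1) obtain M where M: "M \<ge> 0" "\<And>\<tau>. cmod (F \<tau>) \<le> M * ((1 + \<bar>\<tau>\<bar>) powr e * exp (- d * \<bar>\<tau>\<bar>))"
    by (erule growth_boundE)
  define K where "K = max (1 + \<bar>y0\<bar> + \<bar>C\<bar>) (1 + (1 + \<bar>y0\<bar>) / \<bar>C\<bar>)"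
  have "cmod (F (y0 + C * \<tau>)) \<le> (M * K powr \<bar>e\<bar> * exp (\<bar>d\<bar> * \<bar>y0\<bar>)) * ((1 + \<bar>\<tau>\<bar>) powr e * exp (- (\<bar>C\<bar> * d) *
      \<bar>\<tau>\<bar>))" for \<tau>
  proof -
    define y where "y = y0 + C * \<tau>"
    have "1 + \<bar>y\<bar> \<le> 1 + \<bar>y0\<bar> + \<bar>C\<bar> * \<bar>\<tau>\<bar>" by (simp add: y_def abs_mult[symmetric])
    also have "\<dots> \<le> (1 + \<bar>y0\<bar> + \<bar>C\<bar>) * (1 + \<bar>\<tau>\<bar>)" by (simp add: algebra_simps)
    also have "\<dots> \<le> K * (1 + \<bar>\<tau>\<bar>)" by (intro mult_right_mono) (auto simp: K_def)
    finally have 1: "1 + \<bar>y\<bar> \<le> K * (1 + \<bar>\<tau>\<bar>)" .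
    have "\<tau> = (y - y0) / C" using assms by (simp add: y_def)
    hence "1 + \<bar>\<tau>\<bar> \<le> 1 + (\<bar>y\<bar> + \<bar>y0\<bar>) / \<bar>C\<bar>"
      using abs_triangle_ineq4[of y y0] assms by (simp add: divide_right_mono)
    also have "\<dots> \<le> (1 + (1 + \<bar>y0\<bar>) / \<bar>C\<bar>) * (1 + \<bar>y\<bar>)" using assms by (simp add: field_simps)
    also have "\<dots> \<le> K * (1 + \<bar>y\<bar>)" by (intro mult_right_mono) (auto simp: K_def)
    finally have 2: "1 + \<bar>\<tau>\<bar> \<le> K * (1 + \<bar>y\<bar>)" .
    have p: "(1 + \<bar>y\<bar>) powr e \<le> K powr \<bar>e\<bar> * (1 + \<bar>\<tau>\<bar>) powr e"
      by (rule powr_le_of_comparable[OF _ _ 1 2]) auto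
    have "\<bar>\<bar>y\<bar> - \<bar>C\<bar> * \<bar>\<tau>\<bar>\<bar> \<le> \<bar>y0\<bar>" unfolding y_def abs_mult[symmetric] by linarith
    hence "\<bar>d\<bar> * \<bar>\<bar>y\<bar> - \<bar>C\<bar> * \<bar>\<tau>\<bar>\<bar> \<le> \<bar>d\<bar> * \<bar>y0\<bar>" by (intro mult_left_mono) auto
    hence "\<bar>d * (\<bar>y\<bar> - \<bar>C\<bar> * \<bar>\<tau>\<bar>)\<bar> \<le> \<bar>d\<bar> * \<bar>y0\<bar>" by (simp only: abs_mult)
    hence "- d * \<bar>y\<bar> \<le> \<bar>d\<bar> * \<bar>y0\<bar> + - (\<bar>C\<bar> * d) * \<bar>\<tau>\<bar>" by (simp add: abs_le_iff algebra_simps)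
    hence q: "exp (- d * \<bar>y\<bar>) \<le> exp (\<bar>d\<bar> * \<bar>y0\<bar>) * exp (- (\<bar>C\<bar> * d) * \<bar>\<tau>\<bar>)"
      by (simp only: exp_add[symmetric] exp_le_cancel_iff)
    have "cmod (F y) \<le> M * ((1 + \<bar>y\<bar>) powr e * exp (- d * \<bar>y\<bar>))" by (rule M)
    also have "\<dots> \<le> M * ((K powr \<bar>e\<bar> * (1 + \<bar>\<tau>\<bar>) powr e) * (exp (\<bar>d\<bar> * \<bar>y0\<bar>) * exp (- (\<bar>C\<bar> * d) * \<bar>\<tau>\<bar>)))"
      using M(1) p q by (intro mult_left_mono mult_mono) auto
    finally show ?thesis by (simp add: y_def mult_ac)
  qed
  thus ?thesis unfolding growth_bound_def by blast
qed

text \<open>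
  The bound is assumed in logarithmic form, as Stirling's estimate gives it, and away from \<open>y = 0\<close> only;
  compactness settles the rest.
\<close>
lemma growth_boundI_continuous:
  assumes cont: "continuous_on UNIV F"
    and bound: "\<And>y. \<bar>y\<bar> \<ge> 1 \<Longrightarrow> F y \<noteq> 0 \<and> ln (cmod (F y)) \<le> M + e * ln \<bar>y\<bar> - d * \<bar>y\<bar>"
  shows "growth_bound F e d"
proof -
  define w where "w = (\<lambda>\<tau>::real. (1 + \<bar>\<tau>\<bar>) powr e * exp (- d * \<bar>\<tau>\<bar>))"
  have w0: "w \<tau> > 0" for \<tau> by (auto simp: w_def intro!: mult_pos_pos add_pos_nonneg)
  have "continuous_on {-1..1} (\<lambda>\<tau>. F \<tau> / of_real (w \<tau>))"
    using continuous_on_subset[OF cont, of "{-1..1}"] w0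
    by (auto simp: w_def intro!: continuous_intros; smt (verit))
  hence "bounded ((\<lambda>\<tau>. F \<tau> / of_real (w \<tau>)) ` {-1..1})"
    by (intro compact_imp_bounded compact_continuous_image) auto
  then obtain B where B: "\<And>\<tau>. \<tau> \<in> {-1..1} \<Longrightarrow> cmod (F \<tau> / of_real (w \<tau>)) \<le> B"
    unfolding bounded_iff by blast
  have "cmod (F \<tau>) \<le> max B (exp M * 2 powr \<bar>e\<bar>) * w \<tau>" for \<tau>
  proof (cases "\<bar>\<tau>\<bar> \<le> 1")
    case True
    hence "cmod (F \<tau>) \<le> B * w \<tau>" using B[of \<tau>] w0[of \<tau>] by (simp add: norm_divide divide_simps abs_le_iff)
    also have "\<dots> \<le> max B (exp M * 2 powr \<bar>e\<bar>) * w \<tau>" using w0[of \<tau>] by (intro mult_right_mono) auto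
    finally show ?thesis .
  next
    case False
    hence b: "F \<tau> \<noteq> 0" "ln (cmod (F \<tau>)) \<le> M + e * ln \<bar>\<tau>\<bar> - d * \<bar>\<tau>\<bar>" using bound[of \<tau>] by auto
    have "cmod (F \<tau>) = exp (ln (cmod (F \<tau>)))" using b by simp
    also have "\<dots> \<le> exp (M + e * ln \<bar>\<tau>\<bar> - d * \<bar>\<tau>\<bar>)" using b(2) by (simp only: exp_le_cancel_iff)
    also have "\<dots> = exp M * (\<bar>\<tau>\<bar> powr e * exp (- d * \<bar>\<tau>\<bar>))"
      using False by (simp add: powr_def exp_add exp_diff exp_minus field_simps)
    also have "\<dots> \<le> exp M * ((2 powr \<bar>e\<bar> * (1 + \<bar>\<tau>\<bar>) powr e) * exp (- d * \<bar>\<tau>\<bar>))"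
      using False by (intro mult_left_mono mult_right_mono powr_le_of_comparable) auto
    also have "\<dots> = exp M * 2 powr \<bar>e\<bar> * w \<tau>" by (simp add: w_def)
    also have "\<dots> \<le> max B (exp M * 2 powr \<bar>e\<bar>) * w \<tau>" using w0[of \<tau>] by (intro mult_right_mono) auto
    finally show ?thesis .
  qed
  thus ?thesis unfolding growth_bound_def w_def by blast
qed

lemma Complex_nonpos_Ints_iff: "Complex a y \<in> \<int>\<^sub>\<le>\<^sub>0 \<longleftrightarrow> y = 0 \<and> a \<in> \<int>\<^sub>\<le>\<^sub>0"
  by (auto elim!: nonpos_Ints_cases simp: complex_eq_iff nonpos_Ints_of_int)
     (auto simp: nonpos_Ints_def complex_eq_iff)

text \<open>
  As \<open>rGamma\<close> is entire, a pole of \<open>\<Gamma>\<close> on the line does no harm here; this is what the denominator of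
  the kernel needs, whose factors may have poles on the contour.
\<close>
lemma growth_bound_rGamma: "growth_bound (\<lambda>y. rGamma (Complex a y)) (1/2 - a) (- pi / 2)"
proof -
  obtain M where M: "\<And>y. 1 \<le> \<bar>y\<bar> \<Longrightarrow>
     \<bar>ln (cmod (Gamma (Complex a y))) - ((a - 1/2) * ln \<bar>y\<bar> - pi / 2 * \<bar>y\<bar>)\<bar> \<le> M"
    using ln_norm_Gamma_bound[of a] by blast
  show ?thesis
  proof (rule growth_boundI_continuous)
    show "continuous_on UNIV (\<lambda>y. rGamma (Complex a y))"
      unfolding Complex_eq by (intro continuous_on_compose2[OF continuous_on_rGamma[of UNIV]]
          continuous_intros) auto
    fix y :: real assume y: "\<bar>y\<bar> \<ge> 1"
    have n: "Complex a y \<notin> \<int>\<^sub>\<le>\<^sub>0" using y by (auto simp: Complex_nonpos_Ints_iff)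
    hence "Gamma (Complex a y) \<noteq> 0" by (simp add: Gamma_eq_zero_iff)
    thus "rGamma (Complex a y) \<noteq> 0 \<and>
         ln (cmod (rGamma (Complex a y))) \<le> M + (1/2 - a) * ln \<bar>y\<bar> - (- pi / 2) * \<bar>y\<bar>"
      using M[OF y] by (simp add: rGamma_inverse_Gamma norm_inverse ln_inverse abs_le_iff algebra_simps)
  qed
qed

lemma growth_bound_Gamma:
  assumes "a \<notin> \<int>\<^sub>\<le>\<^sub>0"
  shows "growth_bound (\<lambda>y. Gamma (Complex a y)) (a - 1/2) (pi / 2)"
proof -
  obtain M where M: "\<And>y. 1 \<le> \<bar>y\<bar> \<Longrightarrow>
     \<bar>ln (cmod (Gamma (Complex a y))) - ((a - 1/2) * ln \<bar>y\<bar> - pi / 2 * \<bar>y\<bar>)\<bar> \<le> M"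
    using ln_norm_Gamma_bound[of a] by blast
  have n: "Complex a y \<notin> \<int>\<^sub>\<le>\<^sub>0" for y using assms by (auto simp: Complex_nonpos_Ints_iff)
  show ?thesis
  proof (rule growth_boundI_continuous)
    show "continuous_on UNIV (\<lambda>y. Gamma (Complex a y))"
      using n unfolding Complex_eq
      by (intro continuous_on_compose2[OF continuous_on_Gamma[of "- \<int>\<^sub>\<le>\<^sub>0"]] continuous_intros) auto
    fix y :: real assume y: "\<bar>y\<bar> \<ge> 1"
    from n[of y] have "Gamma (Complex a y) \<noteq> 0" by (simp add: Gamma_eq_zero_iff)
    thus "Gamma (Complex a y) \<noteq> 0 \<and>
         ln (cmod (Gamma (Complex a y))) \<le> M + (a - 1/2) * ln \<bar>y\<bar> - (pi / 2) * \<bar>y\<bar>"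
      using M[OF y] by (simp add: abs_le_iff algebra_simps)
  qed
qed

lemma integrable_one_plus_abs_powr:
  assumes "e < -1"
  shows "integrable lborel (\<lambda>\<tau>::real. (1 + \<bar>\<tau>\<bar>) powr e)"
proof -
  define g where "g = (\<lambda>\<tau>::real. (1 + \<bar>\<tau>\<bar>) powr e * indicator {0..} \<tau>)"
  have lim: "((\<lambda>\<tau>. (1 + \<tau>) powr (e + 1) / (e + 1)) \<longlongrightarrow> 0) at_top"
  proof -
    have "((\<lambda>\<tau>. (1 + \<tau>) powr (e + 1) / (e + 1)) \<longlongrightarrow> 0 / (e + 1)) at_top"
      using assms by (intro tendsto_intros tendsto_neg_powr filterlim_tendsto_add_at_top[OF tendsto_const]
          filterlim_ident) auto
    thus ?thesis by simp
  qed
  have "(\<integral>\<^sup>+\<tau>. ennreal ((1 + \<bar>\<tau>\<bar>) powr e) * indicator {0..} \<tau> \<partial>lborel)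
      = ennreal (0 - (1 + 0) powr (e + 1) / (e + 1))"
  proof (rule nn_integral_FTC_atLeast[OF _ _ _ lim])
    fix \<tau> :: real assume "0 \<le> \<tau>"
    thus "((\<lambda>\<tau>. (1 + \<tau>) powr (e + 1) / (e + 1)) has_real_derivative (1 + \<bar>\<tau>\<bar>) powr e) (at \<tau>)"
      using assms by (auto intro!: derivative_eq_intros)
  qed auto
  hence "(\<integral>\<^sup>+\<tau>. ennreal (g \<tau>) \<partial>lborel) < \<infinity>"
    unfolding g_def by (simp add: ennreal_mult'' ennreal_indicator)
  hence g: "integrable lborel g"
    by (intro integrableI_nonneg) (auto simp: g_def)
  have g': "integrable lborel (\<lambda>\<tau>. g (0 + (- 1) * \<tau>))"
    by (rule lborel_integrable_real_affine[OF g]) simp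
  show ?thesis
    by (rule Bochner_Integration.integrable_bound[OF Bochner_Integration.integrable_add[OF g g']])
       (auto simp: g_def indicator_def)
qed

text \<open>
  The two cases are those of the convergence conditions of the \<open>I\<close>-function: if the exponential decay
  is strictly stronger than \<open>exp(\<theta> \<tau>)\<close>, it beats every power; if the two balance, the power
  itself must be integrable.
\<close>
lemma integrable_growth_bound:
  assumes F: "growth_bound F e d" and [measurable]: "F \<in> borel_measurable borel"
    and "\<bar>\<theta>\<bar> < d \<or> \<bar>\<theta>\<bar> = d \<and> e < -1"
  shows "integrable lborel (\<lambda>\<tau>. F \<tau> * of_real (exp (\<theta> * \<tau>)))"
proof -
  obtain e' M where M: "e' < -1" "\<And>\<tau>. cmod (F \<tau> * of_real (exp (\<theta> * \<tau>))) \<le> M * (1 + \<bar>\<tau>\<bar>) powr e'"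
  proof -
    from F obtain M where M: "M \<ge> 0" "\<And>\<tau>. cmod (F \<tau>) \<le> M * ((1 + \<bar>\<tau>\<bar>) powr e * exp (- d * \<bar>\<tau>\<bar>))"
      by (erule growth_boundE)
    have B: "cmod (F \<tau> * of_real (exp (\<theta> * \<tau>))) \<le> M * ((1 + \<bar>\<tau>\<bar>) powr e * exp (- (d - \<bar>\<theta>\<bar>) * \<bar>\<tau>\<bar>))" for \<tau>
    proof -
      have "\<theta> * \<tau> \<le> \<bar>\<theta>\<bar> * \<bar>\<tau>\<bar>" by (metis abs_ge_self abs_mult)
      hence "cmod (F \<tau> * of_real (exp (\<theta> * \<tau>))) \<le> (M * ((1 + \<bar>\<tau>\<bar>) powr e * exp (- d * \<bar>\<tau>\<bar>))) * exp (\<bar>\<theta>\<bar> *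
          \<bar>\<tau>\<bar>)"
        unfolding norm_mult using M by (intro mult_mono) auto
      also have "\<dots> = M * ((1 + \<bar>\<tau>\<bar>) powr e * exp (- (d - \<bar>\<theta>\<bar>) * \<bar>\<tau>\<bar>))"
        by (simp add: algebra_simps flip: exp_add)
      finally show ?thesis .
    qed
    show ?thesis
    proof (cases "\<bar>\<theta>\<bar> = d")
      case True
      thus ?thesis using B assms(3) that[of e M] by auto
    next
      case False
      define \<delta> where "\<delta> = d - \<bar>\<theta>\<bar>"
      have \<delta>: "\<delta> > 0" using False assms(3) by (auto simp: \<delta>_def)
      have "((\<lambda>u::real. u powr (e + 2) * exp (- \<delta> * (u - 1))) \<longlongrightarrow> 0) at_top"
        using \<delta> by real_asymp
      hence "\<forall>\<^sub>F u::real in at_top. u powr (e + 2) * exp (- \<delta> * (u - 1)) < 1"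
        by (rule order_tendstoD) simp
      then obtain T where T: "\<And>u. u \<ge> T \<Longrightarrow> u powr (e + 2) * exp (- \<delta> * (u - 1)) < 1"
        by (auto simp: eventually_at_top_linorder)
      have "continuous_on {1..T} (\<lambda>u::real. u powr (e + 2) * exp (- \<delta> * (u - 1)))"
        by (auto intro!: continuous_intros)
      hence "bounded ((\<lambda>u::real. u powr (e + 2) * exp (- \<delta> * (u - 1))) ` {1..T})"
        by (intro compact_imp_bounded compact_continuous_image) auto
      then obtain B' where B': "\<And>u. u \<in> {1..T} \<Longrightarrow> \<bar>u powr (e + 2) * exp (- \<delta> * (u - 1))\<bar> \<le> B'"
        unfolding bounded_iff real_norm_def by blast
      have "u powr (e + 2) * exp (- \<delta> * (u - 1)) \<le> max 1 B'" if "u \<ge> 1" for u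
        using T[of u] B'[of u] that by (cases "u \<ge> T") (auto simp: le_max_iff_disj)
      hence C: "(1 + \<bar>\<tau>\<bar>) powr (e + 2) * exp (- \<delta> * \<bar>\<tau>\<bar>) \<le> max 1 B'" for \<tau>
        by (metis add_diff_cancel_left' add_increasing2 abs_ge_zero order_refl)
      have "cmod (F \<tau> * of_real (exp (\<theta> * \<tau>))) \<le> (M * max 1 B') * (1 + \<bar>\<tau>\<bar>) powr (-2)" for \<tau>
      proof -
        have "(1 + \<bar>\<tau>\<bar>) powr e * exp (- \<delta> * \<bar>\<tau>\<bar>) = (1 + \<bar>\<tau>\<bar>) powr (e + 2) * exp (- \<delta> * \<bar>\<tau>\<bar>) * (1 +
            \<bar>\<tau>\<bar>) powr (-2)"
          by (simp add: powr_add[symmetric] mult_ac flip: mult.assoc)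
        also have "\<dots> \<le> max 1 B' * (1 + \<bar>\<tau>\<bar>) powr (-2)" by (intro mult_right_mono C) auto
        finally have "M * ((1 + \<bar>\<tau>\<bar>) powr e * exp (- \<delta> * \<bar>\<tau>\<bar>)) \<le> M * (max 1 B' * (1 + \<bar>\<tau>\<bar>) powr (-2))"
          using M(1) by (rule mult_left_mono)
        thus ?thesis using B[of \<tau>] by (simp add: \<delta>_def mult_ac)
      qed
      thus ?thesis by (intro that[of "-2"]) auto
    qed
  qed
  show ?thesis
  proof (rule Bochner_Integration.integrable_bound)
    show "integrable lborel (\<lambda>\<tau>. M * (1 + \<bar>\<tau>\<bar>) powr e')"
      by (intro integrable_mult_right integrable_one_plus_abs_powr M)
    show "AE \<tau> in lborel. norm (F \<tau> * of_real (exp (\<theta> * \<tau>))) \<le> norm (M * (1 + \<bar>\<tau>\<bar>) powr e')"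
      using M(2) by (intro AE_I2) (metis abs_ge_self order_trans real_norm_def)
  qed simp
qed

section \<open>Gauss's summation theorem\<close>

text \<open>
  The coefficients of the Gauss series \<open>\<^sub>2F\<^sub>1(a, b; c; z)\<close>.
\<close>
definition gauss_coeff :: "complex \<Rightarrow> complex \<Rightarrow> complex \<Rightarrow> nat \<Rightarrow> complex" where
  "gauss_coeff a b c n = pochhammer a n * pochhammer b n / (pochhammer c n * fact n)"

text \<open>
  In a quotient of two by two of Gauss's approximations to \<open>1 / \<Gamma>\<close> the factorials cancel, and the
  exponentials combine to a single power of \<open>n\<close>.  With \<open>d = 1\<close> the Pochhammer quotient is a coefficient of
  the Gauss series; with \<open>a + b = c + d\<close> the power is \<open>1\<close>.
\<close>
lemma rGamma_series_quotient:
  assumes "n > 0"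
  shows "rGamma_series a n * rGamma_series b n / (rGamma_series c n * rGamma_series d n) =
         pochhammer a (Suc n) * pochhammer b (Suc n) / (pochhammer c (Suc n) * pochhammer d (Suc n)) *
         (of_nat n powr (c + d - a - b) :: complex)"
proof -
  have quot: "(pa / (f * ea)) * (pb / (f * eb)) / ((pc / (f * ec)) * (pd / (f * ed))) =
        pa * pb / (pc * pd) * (ec * ed / (ea * eb))" if "f \<noteq> 0" for pa pb pc pd f ea eb ec ed :: complex
    using that by (simp add: divide_simps)
  have "exp (c * of_real (ln (of_nat n))) * exp (d * of_real (ln (of_nat n))) /
         (exp (a * of_real (ln (of_nat n))) * exp (b * of_real (ln (of_nat n)))) =
        (of_nat n powr (c + d - a - b) :: complex)"
    using assms by (simp add: powr_def Ln_of_nat exp_add exp_diff algebra_simps)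
  thus ?thesis unfolding rGamma_series_def Suc_eq_plus1 by (subst quot) auto
qed

lemma gauss_coeff_bigo:
  assumes c: "c \<notin> \<int>\<^sub>\<le>\<^sub>0"
  shows "(\<lambda>n. cmod (gauss_coeff a b c n)) \<in> O(\<lambda>n. real n powr (Re (a + b - c) - 1))"
proof -
  \<comment> \<open>coefficient \<open>n + 1\<close> is \<open>R n\<close> times \<open>n powr (a + b - c - 1)\<close>, and \<open>R\<close> converges\<close>
  define e where "e = Re (a + b - c) - 1"
  define R where "R = (\<lambda>n. rGamma_series a n * rGamma_series b n / (rGamma_series c n * rGamma_series 1 n))"
  have "R \<longlonglongrightarrow> rGamma a * rGamma b / (rGamma c * rGamma 1)"
    unfolding R_def using c by (intro tendsto_intros) (auto simp: rGamma_eq_zero_iff)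
  hence L: "(\<lambda>n. cmod (R n)) \<longlonglongrightarrow> cmod (rGamma a * rGamma b / (rGamma c * rGamma 1))"
    by (rule tendsto_norm)
  have eq: "cmod (gauss_coeff a b c (Suc n)) / real n powr e = cmod (R n)" if "n > 0" for n
  proof -
    have p1: "pochhammer 1 (Suc n) = (fact (Suc n) :: complex)" by (metis pochhammer_fact)
    have "R n = gauss_coeff a b c (Suc n) * of_nat n powr (c + 1 - a - b)"
      unfolding R_def rGamma_series_quotient[OF that] gauss_coeff_def p1 ..
    moreover have "cmod (of_nat n powr (c + 1 - a - b)) = real n powr (- e)"
      using norm_powr_real_powr[of "of_nat n" "c + 1 - a - b"] by (simp add: e_def algebra_simps)
    ultimately show ?thesis by (simp add: norm_mult powr_minus divide_inverse)
  qed
  have "(\<lambda>n. cmod (gauss_coeff a b c (Suc n))) \<in> O(\<lambda>n. real n powr e)"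
  proof (rule bigoI_tendsto[OF _ ])
    show "(\<lambda>n. cmod (gauss_coeff a b c (Suc n)) / real n powr e) \<longlonglongrightarrow>
            cmod (rGamma a * rGamma b / (rGamma c * rGamma 1))"
      by (rule Lim_transform_eventually[OF L]) (rule eventually_mono[OF eventually_gt_at_top[of 0]],
          simp add: eq)
    show "\<forall>\<^sub>F n in sequentially. real n powr e \<noteq> 0"
      using eventually_gt_at_top[of 0] by eventually_elim auto
  qed
  from landau_o.big.compose[OF this, of "\<lambda>n. n - 1" sequentially]
  have "(\<lambda>n. cmod (gauss_coeff a b c (Suc (n - 1)))) \<in> O(\<lambda>n. real (n - 1) powr e)"
    by (simp add: filterlim_minus_const_nat_at_top)
  also have "?this \<longleftrightarrow> (\<lambda>n. cmod (gauss_coeff a b c n)) \<in> O(\<lambda>n. (real n - 1) powr e)"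
    by (intro landau_o.big.cong_ex eventually_mono[OF eventually_gt_at_top[of 0]]) (auto simp: of_nat_diff)
  also have "(\<lambda>n. (real n - 1) powr e) \<in> O(\<lambda>n. real n powr e)"
    by real_asymp
  finally show ?thesis unfolding e_def .
qed

lemma summable_gauss_coeff:
  assumes "c \<notin> \<int>\<^sub>\<le>\<^sub>0" "Re (c - a - b) > 0"
  shows "summable (\<lambda>n. cmod (gauss_coeff a b c n))"
proof (rule summable_comparison_test_bigo[OF _ gauss_coeff_bigo[OF assms(1)]])
  show "summable (\<lambda>n. norm (real n powr (Re (a + b - c) - 1)))"
    using assms(2) by (simp add: summable_real_powr_iff)
qed

text \<open>
  With \<open>t\<^sub>n\<close> the coefficients, the difference of the two sides telescopes, term by term, along
  \<open>U\<^sub>n = c n t\<^sub>n\<close>; here \<open>U\<^sub>0 = 0\<close>, and \<open>U\<^sub>n \<rightarrow> 0\<close> because \<open>n t\<^sub>n = O(n\<^bsup>-Re (c-a-b)\<^esup>)\<close>.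
\<close>
lemma gauss_sum_contiguous:
  assumes c: "Re c > 0" and cab: "Re (c - a - b) > 0"
  shows "c * (c - a - b) * (\<Sum>n. gauss_coeff a b c n) =
         (c - a) * (c - b) * (\<Sum>n. gauss_coeff a b (c + 1) n)"
proof -
  define t where "t = gauss_coeff a b c"
  define s where "s = gauss_coeff a b (c + 1)"
  define U where "U = (\<lambda>n. c * of_nat n * t n)"
  have c1: "c \<notin> \<int>\<^sub>\<le>\<^sub>0" "c + 1 \<notin> \<int>\<^sub>\<le>\<^sub>0" using c by (auto elim!: nonpos_Ints_cases simp: complex_eq_iff)
  have cn: "c + of_nat n \<noteq> 0" for n using c by (auto simp: complex_eq_iff)
  have pc: "pochhammer c n \<noteq> 0" for n using pochhammer_eq_0_imp_nonpos_Int c1 by blast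
  have t: "t sums (\<Sum>n. t n)" unfolding t_def
    by (intro summable_sums summable_norm_cancel[OF summable_gauss_coeff] c1 cab)
  have s: "s sums (\<Sum>n. s n)" unfolding s_def
    using cab by (intro summable_sums summable_norm_cancel[OF summable_gauss_coeff] c1) auto
  have st: "s n = t n * c / (c + of_nat n)" for n
  proof -
    have "pochhammer (c + 1) n = pochhammer c n * (c + of_nat n) / c"
      using cn[of 0] pochhammer_rec[of c n] pochhammer_Suc[of c n] by (simp add: field_simps)
    thus ?thesis unfolding s_def t_def gauss_coeff_def using cn[of 0] cn[of n] by simp
  qed
  have tS: "t (Suc n) = t n * (a + of_nat n) * (b + of_nat n) / ((c + of_nat n) * of_nat (Suc n))" for n
    unfolding t_def gauss_coeff_def pochhammer_Suc fact_Suc by (simp add: mult_ac)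
  have tele: "c * (c - a - b) * t n - (c - a) * (c - b) * s n = U n - U (Suc n)" for n
  proof -
    have "U (Suc n) = c * t n * (a + of_nat n) * (b + of_nat n) / (c + of_nat n)"
      unfolding U_def tS using of_nat_neq_0[of n, where 'a = complex] cn[of n]
          by (simp add: divide_simps del: of_nat_Suc)
    moreover have "(c * (c - a - b) * t n * (c + of_nat n) - (c - a) * (c - b) * (t n * c)) / (c +
        of_nat n) =
        (c * of_nat n * t n * (c + of_nat n) - c * t n * (a + of_nat n) * (b + of_nat n)) / (c + of_nat n)"
      by (rule arg_cong2[where f = "(/)"]) (simp_all add: algebra_simps)
    ultimately show ?thesis using cn[of n] unfolding U_def st by (simp add: diff_divide_distrib)
  qed
  have "(\<lambda>n. cmod (U n)) \<in> O(\<lambda>n. real n powr (1 + (Re (a + b - c) - 1)))"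
  proof -
    have "(\<lambda>n. cmod (of_nat n) * cmod (t n)) \<in> O(\<lambda>n. real n * real n powr (Re (a + b - c) - 1))"
      unfolding t_def by (intro landau_o.big.mult gauss_coeff_bigo c1) auto
    also have "(\<lambda>n. real n * real n powr (Re (a + b - c) - 1)) \<in> O(\<lambda>n. real n powr (1 + (Re (a +
        b - c) - 1)))"
      by (intro bigthetaD1 bigthetaI_cong eventually_mono[OF eventually_gt_at_top[of 0]]) (simp only:
          powr_add powr_one of_nat_0_le_iff)
    finally have "(\<lambda>n. cmod c * (cmod (of_nat n) * cmod (t n))) \<in> O(\<lambda>n. real n powr (1 + (Re (a +
        b - c) - 1)))"
      by simp
    thus ?thesis by (simp add: U_def norm_mult mult_ac)
  qed
  moreover have "(\<lambda>n. real n powr (1 + (Re (a + b - c) - 1))) \<longlonglongrightarrow> 0"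
    using cab by (intro tendsto_neg_powr filterlim_real_sequentially) auto
  hence "(\<lambda>n. real n powr (1 + (Re (a + b - c) - 1))) \<in> o(\<lambda>_. 1)" by (intro smalloI_tendsto) auto
  ultimately have "(\<lambda>n. cmod (U n)) \<in> o(\<lambda>_. 1)" by (rule landau_o.big_small_trans)
  hence "(\<lambda>n. cmod (U n)) \<longlonglongrightarrow> 0" by (auto dest: smalloD_tendsto)
  hence "U \<longlonglongrightarrow> 0" by (rule tendsto_norm_zero_cancel)
  from telescope_sums'[OF this] have "(\<lambda>n. U n - U (Suc n)) sums (U 0 - 0)" .
  moreover have "(\<lambda>n. U n - U (Suc n)) sums (c * (c - a - b) * (\<Sum>n. t n) - (c - a) * (c - b) * (\<Sum>n. s n))"
    unfolding tele[symmetric] by (intro sums_diff sums_mult t s)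
  ultimately show ?thesis using sums_unique2 unfolding s_def t_def U_def by fastforce
qed

text \<open>
  Gauss's theorem.  Iterating the contiguous relation \<open>m\<close> times writes the sum as \<open>P\<^sub>m F\<^sub>m\<close>, where \<open>F\<^sub>m\<close> is
  the sum with \<open>c + m\<close> in place of \<open>c\<close> and \<open>P\<^sub>m\<close> a quotient of Pochhammer symbols.  As \<open>m \<rightarrow> \<infinity>\<close>, only the
  term \<open>n = 0\<close> of \<open>F\<^sub>m\<close> survives (Tannery's theorem, the series for \<open>c\<close> being a majorant since
  \<open>Re c > 0\<close>), and \<open>P\<^sub>m\<close> tends to a quotient of Gamma values.
\<close>
theorem gauss_summation:
  assumes c: "Re c > 0" and cab: "Re (c - a - b) > 0"
  shows "gauss_coeff a b c sums (Gamma c * Gamma (c - a - b) * rGamma (c - a) * rGamma (c - b))"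
proof -
  have n0: "w \<notin> \<int>\<^sub>\<le>\<^sub>0" "w + of_nat m \<notin> \<int>\<^sub>\<le>\<^sub>0" if "Re w > 0" for w and m :: nat
    using that by (auto elim!: nonpos_Ints_cases simp: complex_eq_iff)
  have pn0: "pochhammer w m \<noteq> 0" if "Re w > 0" for w and m :: nat
    using pochhammer_eq_0_imp_nonpos_Int n0 that by blast
  define F where "F = (\<lambda>m. \<Sum>n. gauss_coeff a b (c + of_nat m) n)"
  define P where "P = (\<lambda>m. pochhammer (c - a) m * pochhammer (c - b) m / (pochhammer c m *
      pochhammer (c - a - b) m))"
  \<comment> \<open>the contiguous relation, iterated\<close>
  have FP: "F 0 = P m * F m" for m
  proof (induction m)
    case (Suc m)
    have "Re (c + of_nat m) > 0" "Re (c + of_nat m - a - b) > 0" using c cab by auto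
    note con = gauss_sum_contiguous[OF this]
    have "c + of_nat m \<noteq> 0" "c + of_nat m - a - b \<noteq> 0" using c cab by (auto simp: complex_eq_iff)
    hence nz: "(c + of_nat m) * (c + of_nat m - a - b) \<noteq> 0" by simp
    have "(c + of_nat m) * (c + of_nat m - a - b) * F m = (c + of_nat m - a) * (c + of_nat m - b) *
        F (Suc m)"
      using con by (simp add: F_def add_ac)
    hence "F m = (c + of_nat m - a) * (c + of_nat m - b) / ((c + of_nat m) * (c + of_nat m - a - b)) *
        F (Suc m)"
      using nz by (simp add: nonzero_eq_divide_eq mult_ac)
    moreover have "P (Suc m) = P m * ((c + of_nat m - a) * (c + of_nat m - b) / ((c + of_nat m) * (c +
        of_nat m - a - b)))"
    proof -
      have "c + of_nat m - a = c - a + of_nat m" "c + of_nat m - b = c - b + of_nat m"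
        "c + of_nat m - a - b = c - a - b + of_nat m" by auto
      thus ?thesis unfolding P_def pochhammer_Suc by (simp only: times_divide_times_eq mult_ac)
    qed
    ultimately show ?case using Suc by simp
  qed (simp add: P_def)
  have "(\<lambda>n. rGamma_series (c - a) n * rGamma_series (c - b) n / (rGamma_series c n *
      rGamma_series (c - a - b) n))
     \<longlonglongrightarrow> rGamma (c - a) * rGamma (c - b) / (rGamma c * rGamma (c - a - b))"
    using n0[OF c] n0[OF cab] by (intro tendsto_intros) (auto simp: rGamma_eq_zero_iff)
  moreover have "\<forall>\<^sub>F n in sequentially. rGamma_series (c - a) n * rGamma_series (c - b) n /
      (rGamma_series c n * rGamma_series (c - a - b) n) = P (Suc n)"
    by (rule eventually_mono[OF eventually_gt_at_top[of 0]]) (simp add: rGamma_series_quotient P_def)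
  ultimately have "(\<lambda>m. P (Suc m)) \<longlonglongrightarrow> rGamma (c - a) * rGamma (c - b) / (rGamma c * rGamma (c - a - b))"
    by (rule Lim_transform_eventually)
  hence P: "P \<longlonglongrightarrow> Gamma c * Gamma (c - a - b) * rGamma (c - a) * rGamma (c - b)"
    by (simp add: filterlim_sequentially_Suc rGamma_inverse_Gamma field_simps)
  have F: "F \<longlonglongrightarrow> (\<Sum>n. if n = 0 then 1 else 0)"
    unfolding F_def
  proof (rule tannerys_theorem[THEN conjunct2, THEN conjunct2])
    show "summable (\<lambda>n. cmod (gauss_coeff a b c n))" by (intro summable_gauss_coeff n0 c cab)
    have le: "cmod (gauss_coeff a b (c + of_nat m) k) \<le> cmod (gauss_coeff a b c k)" for k m :: nat
    proof -
      have "cmod (pochhammer c k) \<le> cmod (pochhammer (c + of_nat m) k)"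
        unfolding pochhammer_prod prod_norm[symmetric]
      proof (intro prod_mono conjI norm_ge_zero)
        fix i :: nat
        have "(Re c + i)^2 \<le> (Re c + m + i)^2" using c by (intro power_mono) auto
        thus "cmod (c + of_nat i) \<le> cmod (c + of_nat m + of_nat i)" by (simp add: cmod_def)
      qed
      thus ?thesis unfolding gauss_coeff_def norm_divide norm_mult
        using pn0[OF c, of k] pn0[of "c + of_nat m" k] c
        by (intro divide_left_mono mult_right_mono mult_pos_pos mult_nonneg_nonneg) auto
    qed
    show "\<forall>\<^sub>F (k, m) in sequentially \<times>\<^sub>F sequentially. cmod (gauss_coeff a b (c + of_nat m) k) \<le>
        cmod (gauss_coeff a b c k)"
      using le by (intro always_eventually) auto
    show "(\<lambda>m. gauss_coeff a b (c + of_nat m) k) \<longlonglongrightarrow> (if k = 0 then 1 else 0)" for k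
    proof (cases k)
      case 0
      thus ?thesis by (simp add: gauss_coeff_def)
    next
      case (Suc j)
      have "filterlim (\<lambda>m. cmod (pochhammer (c + of_nat m) k)) at_top sequentially"
      proof (rule filterlim_at_top_mono[OF filterlim_real_sequentially always_eventually], rule allI)
        fix m :: nat
        have "1 \<le> cmod (pochhammer (c + of_nat m + 1) j)"
          unfolding pochhammer_prod prod_norm[symmetric]
        proof (rule prod_ge_1)
          fix i
          have "1 \<le> Re (c + of_nat m + 1 + of_nat i)" using c by simp
          also have "\<dots> \<le> cmod (c + of_nat m + 1 + of_nat i)" by (rule complex_Re_le_cmod)
          finally show "1 \<le> cmod (c + of_nat m + 1 + of_nat i)" .
        qed
        moreover have "real m \<le> cmod (c + of_nat m)"
          using c complex_Re_le_cmod[of "c + of_nat m"] by simp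
        ultimately have "real m * 1 \<le> cmod (c + of_nat m) * cmod (pochhammer (c + of_nat m + 1) j)"
          by (intro mult_mono) auto
        thus "real m \<le> cmod (pochhammer (c + of_nat m) k)" by (simp add: Suc pochhammer_rec norm_mult)
      qed
      hence "(\<lambda>m. cmod (inverse (pochhammer (c + of_nat m) k))) \<longlonglongrightarrow> 0"
        unfolding norm_inverse by (rule tendsto_inverse_0_at_top)
      hence "(\<lambda>m. inverse (pochhammer (c + of_nat m) k)) \<longlonglongrightarrow> 0" by (rule tendsto_norm_zero_cancel)
      hence "(\<lambda>m. pochhammer a k * pochhammer b k / fact k * inverse (pochhammer (c + of_nat m) k)) \<longlonglongrightarrow>
               pochhammer a k * pochhammer b k / fact k * 0"
        by (intro tendsto_intros)
      thus ?thesis using Suc by (simp add: gauss_coeff_def field_simps)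
    qed
  qed simp
  have "(\<lambda>m. P m * F m) \<longlonglongrightarrow> (Gamma c * Gamma (c - a - b) * rGamma (c - a) * rGamma (c - b)) * (\<Sum>n.
      if n = 0 then 1 else 0)"
    by (intro tendsto_mult P F)
  hence "(\<lambda>m::nat. F 0) \<longlonglongrightarrow> (Gamma c * Gamma (c - a - b) * rGamma (c - a) * rGamma (c - b)) * (\<Sum>n.
      if n = 0 then 1 else 0)"
    by (simp only: FP[symmetric])
  moreover have "(\<Sum>n. if n = 0 then 1 else 0 :: complex) = 1"
    using suminf_finite[of "{0}" "\<lambda>n. if n = 0 then 1 else 0 :: complex"] by simp
  ultimately have "F 0 = Gamma c * Gamma (c - a - b) * rGamma (c - a) * rGamma (c - b)"
    by (simp add: LIMSEQ_const_iff)
  thus ?thesis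
    using summable_sums[OF summable_norm_cancel[OF summable_gauss_coeff[OF n0(1)[OF c] cab]]]
    by (simp add: F_def)
qed

section \<open>Beta integrals\<close>

lemma norm_of_real_powr: "t > 0 \<Longrightarrow> cmod (of_real t powr w) = t powr Re w"
  by (simp add: norm_powr_real_powr)

lemma of_real_powr_conv_exp: "t > 0 \<Longrightarrow> of_real t powr w = exp (w * of_real (ln t) :: complex)"
  by (simp add: powr_def Ln_of_real)

lemma set_integrable_Beta_kernel:
  fixes p q :: complex
  assumes "Re p > 0" "Re q > 0"
  shows "set_integrable lborel {0<..<1} (\<lambda>t. of_real t powr (p - 1) * of_real (1 - t) powr (q - 1))"
proof -
  have "set_integrable lborel {0<..<1} (\<lambda>t. t powr (Re p - 1) * (1 - t) powr (Re q - 1))"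
    by (rule set_integrable_subset[OF integrable_Beta[OF assms]]) auto
  thus ?thesis
  proof (rule set_integrable_bound)
    have "(\<lambda>t. indicator {0<..<1} t *\<^sub>R (complex_of_real t powr (p - 1) * of_real (1 - t) powr (q - 1))) \<in>
        borel_measurable borel"
      by (rule borel_measurable_continuous_on_indicator) (auto intro!: continuous_intros)
    thus "set_borel_measurable lborel {0<..<1} (\<lambda>t. complex_of_real t powr (p - 1) *
        of_real (1 - t) powr (q - 1))"
      by (simp add: set_borel_measurable_def)
    show "AE t in lborel. t \<in> {0<..<1} \<longrightarrow> norm (complex_of_real t powr (p - 1) *
        of_real (1 - t) powr (q - 1))
        \<le> norm (t powr (Re p - 1) * (1 - t) powr (Re q - 1))"
      by (auto intro!: AE_I2 simp: norm_mult norm_of_real_powr simp del: of_real_diff)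
  qed
qed

lemma integral_Beta_kernel_real:
  assumes "a > 0" "b > (0::real)"
  shows "(LINT t:{0<..<1}|lborel. t powr (a - 1) * (1 - t) powr (b - 1)) = Beta a b"
proof -
  have "set_integrable lborel {0<..<1} (\<lambda>t. t powr (a - 1) * (1 - t) powr (b - 1))"
    by (rule set_integrable_subset[OF integrable_Beta[OF assms]]) auto
  from set_borel_integral_eq_integral(2)[OF this] show ?thesis
    using has_integral_Beta_real[OF assms] by (simp add: has_integral_Icc_iff_Ioo integral_unique)
qed

lemma integral_power_unit_interval:
  assumes "Re p > 0"
  shows "set_integrable lborel {0<..<1} (\<lambda>t. of_real t powr (p - 1))"
    and "(CLINT t:{0<..<1}|lborel. of_real t powr (p - 1)) = 1 / p"
proof -
  have "set_integrable lborel {0<..<1} (\<lambda>t. of_real t powr (p - 1) * of_real (1 - t) powr (1 - 1))"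
    by (rule set_integrable_Beta_kernel) (use assms in auto)
  thus *: "set_integrable lborel {0<..<1} (\<lambda>t. of_real t powr (p - 1))"
    by (rule set_integrable_cong[THEN iffD1, rotated 3]) (auto simp: powr_def)
  have "((\<lambda>t. complex_of_real t powr (p - 1)) has_integral (of_real 1 powr p / p - of_real 0 powr p / p))
      {0..1}"
    using assms by (intro fundamental_theorem_of_calculus_interior)
         (auto intro!: continuous_intros derivative_eq_intros has_vector_derivative_real_field)
  hence "((\<lambda>t. complex_of_real t powr (p - 1)) has_integral (1 / p)) {0<..<1}"
    by (simp add: has_integral_Icc_iff_Ioo)
  thus "(CLINT t:{0<..<1}|lborel. of_real t powr (p - 1)) = 1 / p"
    using set_borel_integral_eq_integral(2)[OF *] by (simp add: integral_unique)
qed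

lemma one_minus_powr_sums:
  assumes "0 < t" "t < 1"
  shows "(\<lambda>n. pochhammer (1 - q) n / fact n * of_real t ^ n) sums (of_real (1 - t) powr (q - 1) :: complex)"
proof -
  have "(\<lambda>n. ((q - 1) gchoose n) * (- of_real t) ^ n) sums (1 + - of_real t) powr (q - 1 :: complex)"
    by (rule gen_binomial_complex) (use assms in auto)
  moreover have "((q - 1) gchoose n) * (- of_real t) ^ n = pochhammer (1 - q) n / fact n * of_real t ^ n"
      for n
    by (cases "even n") (simp_all add: gbinomial_pochhammer)
  ultimately show ?thesis by simp
qed

lemma termwise_set_integral:
  fixes c :: "nat \<Rightarrow> complex" and g :: "nat \<Rightarrow> real \<Rightarrow> complex"
  assumes int: "\<And>n. set_integrable lborel A (g n)"
    and pt: "\<And>t. t \<in> A \<Longrightarrow> summable (\<lambda>n. cmod (c n * g n t))"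
    and sm: "summable (\<lambda>n. cmod (c n) * (LINT t:A|lborel. cmod (g n t)))"
    and eq: "\<And>t. t \<in> A \<Longrightarrow> f t = (\<Sum>n. c n * g n t)"
  shows "set_integrable lborel A f"
    and "(\<lambda>n. c n * (CLINT t:A|lborel. g n t)) sums (CLINT t:A|lborel. f t)"
proof -
  define h where "h = (\<lambda>n t. indicator A t *\<^sub>R (c n * g n t))"
  have h: "integrable lborel (h n)" for n
    using set_integrable_mult_right[of "c n", OF int[of n]] by (simp add: h_def set_integrable_def)
  have fh: "(\<lambda>t. indicator A t *\<^sub>R f t) = (\<lambda>t. \<Sum>n. h n t)"
    by (auto simp: h_def eq indicator_def fun_eq_iff)
  have 1: "AE t in lborel. summable (\<lambda>n. norm (h n t))"
  proof (rule AE_I2)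
    fix t show "summable (\<lambda>n. norm (h n t))"
      using pt[of t] by (cases "t \<in> A") (auto simp: h_def)
  qed
  have "(\<integral>t. norm (h n t) \<partial>lborel) = cmod (c n) * (LINT t:A|lborel. cmod (g n t))" for n
    unfolding set_lebesgue_integral_def integral_mult_right_zero[symmetric]
    by (intro Bochner_Integration.integral_cong) (auto simp: h_def norm_mult indicator_def)
  hence 2: "summable (\<lambda>n. \<integral>t. norm (h n t) \<partial>lborel)" using sm by simp
  show "set_integrable lborel A f"
    unfolding set_integrable_def fh by (rule integrable_suminf[OF h 1 2])
  have "(\<lambda>n. \<integral>t. h n t \<partial>lborel) sums (CLINT t:A|lborel. f t)"
    unfolding set_lebesgue_integral_def fh by (rule sums_integral[OF h 1 2])
  moreover have "(\<integral>t. h n t \<partial>lborel) = c n * (CLINT t:A|lborel. g n t)" for n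
    unfolding set_lebesgue_integral_def integral_mult_right_zero[symmetric]
    by (intro Bochner_Integration.integral_cong) (auto simp: h_def indicator_def)
  ultimately show "(\<lambda>n. c n * (CLINT t:A|lborel. g n t)) sums (CLINT t:A|lborel. f t)" by simp
qed

text \<open>
  The coefficients grow at most polynomially; the factor \<open>s > 1\<close> below, chosen with \<open>s t = (1 + t) / 2\<close>,
  absorbs this growth.
\<close>
lemma summable_gauss_coeff_power:
  assumes "c \<notin> \<int>\<^sub>\<le>\<^sub>0" "0 < t" "t < 1"
  shows "summable (\<lambda>n. cmod (gauss_coeff a b c n * of_real t ^ n))"
proof (rule summable_comparison_test_bigo)
  show "summable (\<lambda>n. norm (((1 + t) / 2) ^ n))"
    unfolding norm_power using assms by (intro summable_geometric) auto
  define s where "s = (1 + t) / (2 * t)"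
  have "(\<lambda>n. cmod (gauss_coeff a b c n) * t ^ n) \<in> O(\<lambda>n. real n powr (Re (a + b - c) - 1) * t ^ n)"
    by (intro landau_o.big.mult gauss_coeff_bigo assms) auto
  also have "(\<lambda>n. real n powr (Re (a + b - c) - 1) * t ^ n) \<in> O(\<lambda>n. s ^ n * t ^ n)"
  proof (rule landau_o.big.mult_right)
    have "s > 1" using assms by (simp add: s_def field_simps)
    thus "(\<lambda>n. real n powr (Re (a + b - c) - 1)) \<in> O(\<lambda>n. s ^ n)" by real_asymp
  qed
  also have "(\<lambda>n. s ^ n * t ^ n) = (\<lambda>n. ((1 + t) / 2) ^ n)"
    using assms by (simp add: s_def flip: power_mult_distrib)
  finally show "(\<lambda>n. cmod (gauss_coeff a b c n * of_real t ^ n)) \<in> O(\<lambda>n. ((1 + t) / 2) ^ n)"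
    using assms by (simp add: norm_mult norm_power)
qed

lemma not_nonpos_Int_Re_pos: "Re z > 0 \<Longrightarrow> z \<notin> \<int>\<^sub>\<le>\<^sub>0"
  by (auto elim!: nonpos_Ints_cases simp: complex_eq_iff)

text \<open>
  Expanding \<open>(1 - t)\<^bsup>q-1\<^esup>\<close> by the binomial series and integrating termwise yields
  \<open>(1 / p) \<^sub>2F\<^sub>1(1 - q, p; p + 1; 1)\<close>, and Gauss's theorem evaluates this.
\<close>
theorem integral_Beta_kernel:
  fixes p q :: complex
  assumes p: "Re p > 0" and q: "Re q > 0"
  shows "(CLINT t:{0<..<1}|lborel. of_real t powr (p - 1) * of_real (1 - t) powr (q - 1)) = Beta p q"
proof -
  define g where "g = (\<lambda>n t. complex_of_real t powr (p + of_nat n - 1))"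
  define c where "c = gauss_coeff (1 - q) 1 1"
  have c: "c n = pochhammer (1 - q) n / fact n" for n
    by (simp add: c_def gauss_coeff_def pochhammer_fact[symmetric])
  have gt: "g n t = of_real t powr (p - 1) * of_real t ^ n" if "t \<in> {0<..<1}" for n t
    using that by (simp add: g_def powr_add powr_diff powr_nat' mult_ac)
  have ip: "(CLINT t:{0<..<1}|lborel. g n t) = 1 / (p + of_nat n)"
       "set_integrable lborel {0<..<1} (g n)" for n
    using integral_power_unit_interval[of "p + of_nat n"] p by (simp_all add: g_def)
  have "(\<lambda>n. c n * (CLINT t:{0<..<1}|lborel. g n t)) sums
      (CLINT t:{0<..<1}|lborel. of_real t powr (p - 1) * of_real (1 - t) powr (q - 1))"
  proof (rule termwise_set_integral(2)[OF ip(2)])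
    fix t :: real assume t: "t \<in> {0<..<1}"
    have "summable (\<lambda>n. cmod (of_real t powr (p - 1)) * cmod (c n * of_real t ^ n))"
      unfolding c_def using t
          by (intro summable_mult summable_gauss_coeff_power) (auto simp: not_nonpos_Int_Re_pos)
    thus "summable (\<lambda>n. cmod (c n * g n t))" using t by (simp add: gt norm_mult mult_ac)
    have "(\<lambda>n. of_real t powr (p - 1) * (c n * of_real t ^ n)) sums (of_real t powr (p - 1) *
        of_real (1 - t) powr (q - 1))"
      unfolding c using t by (intro sums_mult one_minus_powr_sums) auto
    thus "of_real t powr (p - 1) * of_real (1 - t) powr (q - 1) = (\<Sum>n. c n * g n t)"
      using t by (simp add: gt sums_iff mult_ac)
  next
    have "(LINT t:{0<..<1}|lborel. cmod (g n t)) = 1 / (Re p + n)" for n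
    proof -
      have "complex_of_real (LINT t:{0<..<1}|lborel. cmod (g n t)) =
          (CLINT t:{0<..<1}|lborel. of_real (cmod (g n t)))"
        by (rule set_integral_complex_of_real[symmetric])
      also have "\<dots> = (CLINT t:{0<..<1}|lborel. of_real t powr (of_real (Re p + n) - 1))"
        by (intro set_lebesgue_integral_cong) (auto simp: g_def norm_of_real_powr powr_of_real[symmetric])
      also have "\<dots> = of_real (1 / (Re p + n))"
        using integral_power_unit_interval(2)[of "of_real (Re p + n)"] p by simp
      finally show ?thesis unfolding of_real_eq_iff .
    qed
    moreover have "summable (\<lambda>n. cmod (c n) * (1 / (Re p + n)))"
    proof (rule summable_comparison_test_bigo)
      show "summable (\<lambda>n. norm (real n powr (- Re q - 1)))"
        using q by (simp add: summable_real_powr_iff)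
      have "(\<lambda>n. cmod (c n)) \<in> O(\<lambda>n. real n powr (- Re q))"
        using gauss_coeff_bigo[of 1 "1 - q" 1] by (simp add: c_def not_nonpos_Int_Re_pos)
      moreover have "(\<lambda>n. 1 / (Re p + real n)) \<in> O(\<lambda>n. real n powr (-1))" by real_asymp
      ultimately have "(\<lambda>n. cmod (c n) * (1 / (Re p + real n))) \<in> O(\<lambda>n. real n powr (- Re q) *
          real n powr (-1))"
        by (rule landau_o.big.mult)
      thus "(\<lambda>n. cmod (c n) * (1 / (Re p + real n))) \<in> O(\<lambda>n. real n powr (- Re q - 1))"
        by (simp only: powr_add[symmetric] diff_conv_add_uminus)
    qed
    ultimately show "summable (\<lambda>n. cmod (c n) * (LINT t:{0<..<1}|lborel. cmod (g n t)))" by simp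
  qed
  moreover have "(\<lambda>n. c n * (CLINT t:{0<..<1}|lborel. g n t)) sums Beta p q"
  proof -
    have p0: "p + of_nat n \<noteq> 0" for n using p by (auto simp: complex_eq_iff)
    have pp: "p * pochhammer (p + 1) n = pochhammer p n * (p + of_nat n)" for n
      using pochhammer_rec[of p n] pochhammer_Suc[of p n] by simp
    have pn0: "pochhammer p n \<noteq> 0" for n
      using pochhammer_eq_0_imp_nonpos_Int not_nonpos_Int_Re_pos[OF p] by blast
    have "c n * (CLINT t:{0<..<1}|lborel. g n t) = 1 / p * gauss_coeff (1 - q) p (p + 1) n" for n
    proof -
      have "1 / (p + of_nat n) = pochhammer p n / (p * pochhammer (p + 1) n)"
        unfolding pp using pn0[of n] p0[of n] by simp
      thus ?thesis unfolding ip c gauss_coeff_def by simp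
    qed
    moreover have "(\<lambda>n. 1 / p * gauss_coeff (1 - q) p (p + 1) n) sums
       (1 / p * (Gamma (p + 1) * Gamma (p + 1 - (1 - q) - p) * rGamma (p + 1 - (1 - q)) * rGamma (p +
           1 - p)))"
      using p q by (intro sums_mult gauss_summation) auto
    moreover have "1 / p * (Gamma (p + 1) * Gamma (p + 1 - (1 - q) - p) * rGamma (p + 1 - (1 - q)) *
        rGamma (p + 1 - p)) = Beta p q"
      using Gamma_plus1[OF not_nonpos_Int_Re_pos[OF p]] p0[of 0] by (simp add: Beta_altdef)
    ultimately show ?thesis by simp
  qed
  ultimately show ?thesis by (rule sums_unique2)
qed

text \<open>
  The \<open>n\<close>-th term of the Gauss series contributes \<open>Beta (c + n) \<sigma>\<close>, which is \<open>Beta c \<sigma>\<close> times the quotient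
  of Pochhammer symbols that replaces \<open>c\<close> by \<open>c + \<sigma>\<close> in the coefficient; the sum is then Gauss's.
  The integrals of the absolute values are \<open>Beta (Re c + n) (Re \<sigma>) = O(n\<^bsup>-Re \<sigma>\<^esup>)\<close>, and with the
  coefficients \<open>O(n\<^bsup>Re (A+B-c)-1\<^esup>)\<close> they are summable by the last hypothesis.
\<close>
theorem hypergeometric_Beta_integral:
  fixes A B c \<sigma> :: complex
  assumes c: "Re c > 0" and \<sigma>: "Re \<sigma> > 0" and conv: "Re (c + \<sigma> - A - B) > 0"
  shows "set_integrable lborel {0<..<1} (\<lambda>u. of_real u powr (c - 1) * of_real (1 - u) powr (\<sigma> - 1) *
      hyp2F1 A B c (of_real u))"
    and "(CLINT u:{0<..<1}|lborel. of_real u powr (c - 1) * of_real (1 - u) powr (\<sigma> - 1) *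
        hyp2F1 A B c (of_real u)) =
           Gamma c * Gamma \<sigma> * Gamma (c + \<sigma> - A - B) * rGamma (c + \<sigma> - A) * rGamma (c + \<sigma> - B)"
proof -
  define g where "g = (\<lambda>n u. complex_of_real u powr (c + of_nat n - 1) * of_real (1 - u) powr (\<sigma> - 1))"
  define t where "t = gauss_coeff A B c"
  have c0: "c \<notin> \<int>\<^sub>\<le>\<^sub>0" by (rule not_nonpos_Int_Re_pos[OF c])
  have gu: "g n u = of_real u powr (c - 1) * of_real (1 - u) powr (\<sigma> - 1) * of_real u ^ n" if "u \<in> {0<..<1}"
      for n u
    using that by (simp add: g_def powr_add powr_diff powr_nat' mult_ac)
  have ig: "(CLINT u:{0<..<1}|lborel. g n u) = Beta (c + of_nat n) \<sigma>"
       "set_integrable lborel {0<..<1} (g n)" for n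
    unfolding g_def using c \<sigma> by (intro integral_Beta_kernel set_integrable_Beta_kernel; simp)+
  have Betan: "Beta (z + of_nat n) w = Beta z w * (pochhammer z n / pochhammer (z + w) n)"
    if "Re z > 0" "Re w > 0" for z w :: complex and n
  proof -
    have 1: "z \<notin> \<int>\<^sub>\<le>\<^sub>0" "z + w \<notin> \<int>\<^sub>\<le>\<^sub>0" using that by (auto intro!: not_nonpos_Int_Re_pos)
    hence "Gamma z \<noteq> 0" "Gamma (z + w) \<noteq> 0" by (auto simp: Gamma_eq_zero_iff)
    moreover have "z + of_nat n + w = z + w + of_nat n" by simp
    moreover have "Gamma (z + w + of_nat n) \<noteq> 0"
      using that not_nonpos_Int_Re_pos[of "z + w + of_nat n"] by (simp add: Gamma_eq_zero_iff)
    ultimately show ?thesis unfolding Beta_def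
        using pochhammer_Gamma[OF 1(1), of n] pochhammer_Gamma[OF 1(2), of n]
      by (simp only:) (simp add: divide_simps)
  qed
  have h: "hyp2F1 A B c z = (\<Sum>n. t n * z ^ n)" for z
    unfolding hyp2F1_def eval_fps_def by (simp add: t_def gauss_coeff_def)
  have pt: "summable (\<lambda>n. cmod (t n * g n u))" if u: "u \<in> {0<..<1}" for u
  proof -
    have "summable (\<lambda>n. cmod (of_real u powr (c - 1) * of_real (1 - u) powr (\<sigma> - 1)) * cmod (t n *
        of_real u ^ n))"
      unfolding t_def using u by (intro summable_mult summable_gauss_coeff_power c0) auto
    thus ?thesis using u by (simp add: gu norm_mult mult_ac)
  qed
  have eq: "of_real u powr (c - 1) * of_real (1 - u) powr (\<sigma> - 1) * hyp2F1 A B c (of_real u) =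
      (\<Sum>n. t n * g n u)"
    if u: "u \<in> {0<..<1}" for u
  proof -
    have "summable (\<lambda>n. t n * of_real u ^ n)"
      unfolding t_def using u by (intro summable_norm_cancel[OF summable_gauss_coeff_power] c0) auto
    from suminf_mult[OF this, of "of_real u powr (c - 1) * of_real (1 - u) powr (\<sigma> - 1)"]
    show ?thesis unfolding h by (simp only: gu[OF u] mult_ac)
  qed
  have sm: "summable (\<lambda>n. cmod (t n) * (LINT u:{0<..<1}|lborel. cmod (g n u)))"
  proof -
    have "(LINT u:{0<..<1}|lborel. cmod (g n u)) =
       cmod (Beta (of_real (Re c)) (of_real (Re \<sigma>)) * gauss_coeff (of_real (Re c)) 1 (of_real (Re c +
           Re \<sigma>)) n)" for n
    proof -
      have "(LINT u:{0<..<1}|lborel. cmod (g n u)) = (LINT u:{0<..<1}|lborel. u powr (Re c + n - 1) *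
          (1 - u) powr (Re \<sigma> - 1))"
        by (intro set_lebesgue_integral_cong) (auto simp: g_def norm_mult norm_of_real_powr simp del:
            of_real_diff)
      also have "\<dots> = Beta (Re c + n) (Re \<sigma>)" using c \<sigma> by (intro integral_Beta_kernel_real) auto
      also have "\<dots> = cmod (Beta (of_real (Re c + n)) (of_real (Re \<sigma>)))"
        using c \<sigma> by (simp only: Beta_complex_of_real norm_of_real) (simp add: Beta_def add_pos_nonneg
            add_pos_pos)
      also have "\<dots> = cmod (Beta (of_real (Re c)) (of_real (Re \<sigma>)) *
          gauss_coeff (of_real (Re c)) 1 (of_real (Re c + Re \<sigma>)) n)"
        using Betan[of "of_real (Re c)" "of_real (Re \<sigma>)" n] c \<sigma>
        by (simp add: gauss_coeff_def pochhammer_fact[symmetric])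
      finally show ?thesis .
    qed
    moreover have "summable (\<lambda>n. cmod (t n) * cmod (Beta (of_real (Re c)) (of_real (Re \<sigma>)) *
        gauss_coeff (of_real (Re c)) 1 (of_real (Re c + Re \<sigma>)) n))"
    proof (rule summable_comparison_test_bigo)
      show "summable (\<lambda>n. norm (real n powr (Re (A + B - c) - 1 - Re \<sigma>)))"
        using conv by (simp add: summable_real_powr_iff)
      have "(\<lambda>n. cmod (gauss_coeff (of_real (Re c)) 1 (of_real (Re c + Re \<sigma>)) n)) \<in>
          O(\<lambda>n. real n powr (- Re \<sigma>))"
        using gauss_coeff_bigo[of "of_real (Re c + Re \<sigma>)" "of_real (Re c)" 1] c \<sigma>
            by (simp add: not_nonpos_Int_Re_pos)
      hence "(\<lambda>n. cmod (Beta (of_real (Re c)) (of_real (Re \<sigma>))) *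
          cmod (gauss_coeff (of_real (Re c)) 1 (of_real (Re c + Re \<sigma>)) n)) \<in> O(\<lambda>n. real n powr (- Re \<sigma>))"
        by (cases "Beta (of_real (Re c)) (of_real (Re \<sigma>)) = (0 :: complex)") simp_all
      from landau_o.big.mult[OF gauss_coeff_bigo[OF c0, of A B] this]
      show "(\<lambda>n. cmod (t n) * cmod (Beta (of_real (Re c)) (of_real (Re \<sigma>)) *
          gauss_coeff (of_real (Re c)) 1 (of_real (Re c + Re \<sigma>)) n))
          \<in> O(\<lambda>n. real n powr (Re (A + B - c) - 1 - Re \<sigma>))"
        unfolding t_def norm_mult powr_add[symmetric] by (simp add: algebra_simps)
    qed
    ultimately show ?thesis by simp
  qed
  show "set_integrable lborel {0<..<1} (\<lambda>u. of_real u powr (c - 1) * of_real (1 - u) powr (\<sigma> - 1) *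
      hyp2F1 A B c (of_real u))"
    by (rule termwise_set_integral(1)[OF ig(2) pt sm eq])
  have "(\<lambda>n. t n * (CLINT u:{0<..<1}|lborel. g n u)) sums
     (CLINT u:{0<..<1}|lborel. of_real u powr (c - 1) * of_real (1 - u) powr (\<sigma> - 1) *
         hyp2F1 A B c (of_real u))"
    by (rule termwise_set_integral(2)[OF ig(2) pt sm eq])
  moreover have "(\<lambda>n. t n * (CLINT u:{0<..<1}|lborel. g n u)) sums
     (Gamma c * Gamma \<sigma> * Gamma (c + \<sigma> - A - B) * rGamma (c + \<sigma> - A) * rGamma (c + \<sigma> - B))"
  proof -
    have pn0: "pochhammer c n \<noteq> 0" for n
      using pochhammer_eq_0_imp_nonpos_Int c0 by blast
    have "t n * (CLINT u:{0<..<1}|lborel. g n u) = Beta c \<sigma> * gauss_coeff A B (c + \<sigma>) n" for n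
      unfolding ig Betan[OF c \<sigma>] t_def gauss_coeff_def using pn0[of n] by (simp add: mult_ac)
    moreover have "(\<lambda>n. Beta c \<sigma> * gauss_coeff A B (c + \<sigma>) n) sums
       (Beta c \<sigma> * (Gamma (c + \<sigma>) * Gamma (c + \<sigma> - A - B) * rGamma (c + \<sigma> - A) * rGamma (c + \<sigma> - B)))"
      using c \<sigma> conv by (intro sums_mult gauss_summation) auto
    moreover have "Gamma (c + \<sigma>) \<noteq> 0" using c \<sigma> not_nonpos_Int_Re_pos[of "c + \<sigma>"]
        by (simp add: Gamma_eq_zero_iff)
    ultimately show ?thesis by (simp add: Beta_def mult_ac)
  qed
  ultimately show "(CLINT u:{0<..<1}|lborel. of_real u powr (c - 1) * of_real (1 - u) powr (\<sigma> - 1) *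
      hyp2F1 A B c (of_real u)) =
           Gamma c * Gamma \<sigma> * Gamma (c + \<sigma> - A - B) * rGamma (c + \<sigma> - A) * rGamma (c + \<sigma> - B)"
    by (rule sums_unique2)
qed

section \<open>Integrability of the kernel\<close>

lemma on_contour: "c + of_real C * Complex 0 \<tau> = Complex (Re c) (Im c + C * \<tau>)"
  by (simp add: complex_eq_iff)

lemma exp_Gamma_branch:
  assumes "Gamma_branches L" "Re s = 0" "c + of_real C * s \<notin> \<int>\<^sub>\<le>\<^sub>0"
  shows "exp (L c C \<kappa> s) = Gamma (c + of_real C * s)"
  using assms unfolding Gamma_branches_def Let_def contour_line_def contour_abscissa_def by blast

text \<open>
  The modulus does not depend on the branch.  At a pole both sides are \<open>0\<close>, as \<open>Gamma\<close> is \<open>0\<close> there.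
\<close>
lemma norm_Gamma_pow:
  assumes "Gamma_branches L" "Re s = 0"
  shows "cmod (Gamma_pow L c C \<kappa> s) = cmod (Gamma (c + of_real C * s)) powr \<kappa>"
proof (cases "c + of_real C * s \<in> \<int>\<^sub>\<le>\<^sub>0")
  case True
  thus ?thesis by (simp add: Gamma_pow_def Gamma_nonpos_Int)
next
  case False
  have "cmod (Gamma_pow L c C \<kappa> s) = exp (Re (L c C \<kappa> s) * \<kappa>)"
    using False by (simp add: Gamma_pow_def mult.commute)
  also have "\<dots> = cmod (exp (L c C \<kappa> s)) powr \<kappa>" by (simp add: exp_powr_real)
  finally show ?thesis using exp_Gamma_branch[OF assms False] by simp
qed

text \<open>
  For the exponent \<open>1\<close> of the new triples the branch is immaterial.
\<close>
lemma Gamma_pow_one: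
  assumes "Gamma_branches L" "Re s = 0"
  shows "Gamma_pow L c C 1 s = Gamma (c + of_real C * s)"
  using exp_Gamma_branch[OF assms] by (simp add: Gamma_pow_def Gamma_nonpos_Int)

lemma growth_bound_Gamma_pow:
  assumes L: "Gamma_branches L" and "C \<noteq> 0" "\<kappa> > 0" "Re c \<notin> \<int>\<^sub>\<le>\<^sub>0"
  shows "growth_bound (\<lambda>\<tau>. Gamma_pow L c C \<kappa> (Complex 0 \<tau>)) (\<kappa> * (Re c - 1/2)) (pi / 2 * (\<kappa> * \<bar>C\<bar>))"
proof -
  have "growth_bound (\<lambda>\<tau>. Gamma_pow L c C \<kappa> (Complex 0 \<tau>)) (\<kappa> * (Re c - 1/2)) (\<kappa> * (\<bar>C\<bar> * (pi / 2)))"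
    by (rule growth_bound_powr[OF growth_bound_affine[OF growth_bound_Gamma[OF assms(4)] assms(2),
        of "Im c"] assms(3)])
       (simp add: norm_Gamma_pow[OF L] on_contour)
  thus ?thesis by (simp add: mult_ac)
qed

lemma growth_bound_inverse_Gamma_pow:
  assumes L: "Gamma_branches L" and "C \<noteq> 0" "\<kappa> > 0"
  shows "growth_bound (\<lambda>\<tau>. inverse (Gamma_pow L c C \<kappa> (Complex 0 \<tau>))) (\<kappa> * (1/2 - Re c)) (- (pi / 2 * (\<kappa> *
      \<bar>C\<bar>)))"
proof -
  have "growth_bound (\<lambda>\<tau>. inverse (Gamma_pow L c C \<kappa> (Complex 0 \<tau>))) (\<kappa> * (1/2 - Re c)) (\<kappa> * (\<bar>C\<bar> *
      (- pi / 2)))"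
    by (rule growth_bound_powr[OF growth_bound_affine[OF growth_bound_rGamma assms(2), of "Re c" "Im c"]
        assms(3)])
       (simp add: norm_Gamma_pow[OF L] on_contour norm_inverse rGamma_inverse_Gamma inverse_powr)
  thus ?thesis by (simp add: mult_ac)
qed

lemma measurable_Gamma_pow:
  assumes L: "Gamma_branches L"
  shows "(\<lambda>\<tau>. Gamma_pow L c C \<kappa> (Complex 0 \<tau>)) \<in> borel_measurable borel"
proof -
  define A where "A = {\<tau>. c + of_real C * Complex 0 \<tau> \<in> \<int>\<^sub>\<le>\<^sub>0}"
  have "closed ((\<lambda>\<tau>. c + of_real C * Complex 0 \<tau>) -` \<int>\<^sub>\<le>\<^sub>0)"
    unfolding Complex_eq by (intro continuous_closed_vimage closed_nonpos_Ints) (auto intro!: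
        continuous_intros)
  hence A: "closed A" by (simp add: A_def vimage_def)
  have "continuous_on (- A) (\<lambda>\<tau>. L c C \<kappa> (Complex 0 \<tau>))"
  proof (rule continuous_on_compose2[where f = "Complex 0" and g = "L c C \<kappa>"])
    show "continuous_on {s \<in> contour_line. c + of_real C * s \<notin> \<int>\<^sub>\<le>\<^sub>0} (L c C \<kappa>)"
      using L by (simp add: Gamma_branches_def Let_def)
    show "continuous_on (- A) (Complex 0)" unfolding Complex_eq by (intro continuous_intros)
  qed (auto simp: A_def contour_line_def contour_abscissa_def)
  hence "(\<lambda>\<tau>. indicator (- A) \<tau> *\<^sub>R exp (of_real \<kappa> * L c C \<kappa> (Complex 0 \<tau>))) \<in> borel_measurable borel"
    using A by (intro borel_measurable_continuous_on_indicator continuous_intros) (auto simp: borel_closed)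
  also have "(\<lambda>\<tau>. indicator (- A) \<tau> *\<^sub>R exp (of_real \<kappa> * L c C \<kappa> (Complex 0 \<tau>))) =
      (\<lambda>\<tau>. Gamma_pow L c C \<kappa> (Complex 0 \<tau>))"
    by (auto simp: Gamma_pow_def A_def indicator_def fun_eq_iff)
  finally show ?thesis .
qed

lemma measurable_I_kernel:
  assumes L: "Gamma_branches L"
  shows "(\<lambda>\<tau>. I_kernel L m n us ls (Complex 0 \<tau>)) \<in> borel_measurable borel"
  unfolding I_kernel_def case_prod_beta
  by (intro borel_measurable_times borel_measurable_divide borel_measurable_prod measurable_Gamma_pow L)

text \<open>
  If \<open>Re c\<close> were a nonpositive integer, then the contour would pass through the pole
  \<open>s = - \<i> Im c / C\<close>.
\<close>
lemma no_pole_on_contour: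
  assumes "\<And>s. c + of_real C * s \<in> \<int>\<^sub>\<le>\<^sub>0 \<Longrightarrow> Re s \<noteq> 0" "C \<noteq> 0"
  shows "Re c \<notin> \<int>\<^sub>\<le>\<^sub>0"
proof
  assume "Re c \<in> \<int>\<^sub>\<le>\<^sub>0"
  hence "of_real (Re c) \<in> (\<int>\<^sub>\<le>\<^sub>0 :: complex set)"
      by (auto elim!: nonpos_Ints_cases intro: nonpos_Ints_of_int)
  moreover have "c + of_real C * Complex 0 (- Im c / C) = of_real (Re c)"
    using assms(2) by (simp add: complex_eq_iff)
  ultimately show False using assms(1)[of "Complex 0 (- Im c / C)"] by simp
qed

text \<open>
  By the symmetry \<open>w \<mapsto> 1 - w\<close> a lower triple has the exponent \<open>\<kappa> (Re b - 1/2)\<close> and an upper one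
  \<open>\<kappa> (1/2 - Re a)\<close>, no matter on which side of the fraction it stands, while the side decides the sign
  of its rate \<open>\<pi> \<kappa> C / 2\<close>.  Hence the totals \<open>\<Omega>\<close> and \<open>\<pi> \<Delta> / 2\<close>.
\<close>
lemma growth_bound_I_kernel:
  assumes L: "Gamma_branches L" and P: "I_params m n us ls"
  shows "growth_bound (\<lambda>\<tau>. I_kernel L m n us ls (Complex 0 \<tau>)) (I_Omega us ls) (pi / 2 * I_Delta m n us ls)"
proof -
  from P have mn: "m \<le> length ls" "n \<le> length us"
    and us: "\<And>i. i < length us \<Longrightarrow> (case us ! i of (a, A, \<kappa>) \<Rightarrow> A > 0 \<and> \<kappa> > 0)"
    and ls: "\<And>j. j < length ls \<Longrightarrow> (case ls ! j of (b, B, \<kappa>) \<Rightarrow> B > 0 \<and> \<kappa> > 0)"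
    and pl: "\<And>j. j < m \<Longrightarrow> (case ls ! j of (b, B, \<kappa>) \<Rightarrow>
        \<forall>s. b + of_real B * s \<in> \<int>\<^sub>\<le>\<^sub>0 \<longrightarrow> Re s < 0)"
    and pu: "\<And>i. i < n \<Longrightarrow> (case us ! i of (a, A, \<kappa>) \<Rightarrow>
        \<forall>s. 1 - a - of_real A * s \<in> \<int>\<^sub>\<le>\<^sub>0 \<longrightarrow> Re s > 0)"
    unfolding I_params_def contour_abscissa_def by (force dest!: nth_mem)+
  define eb where "eb = (\<lambda>j. case ls ! j of (b, B, \<kappa>) \<Rightarrow> \<kappa> * (Re b - 1/2))"
  define ea where "ea = (\<lambda>i. case us ! i of (a, A, \<kappa>) \<Rightarrow> \<kappa> * (1/2 - Re a))"
  define db where "db = (\<lambda>j. case ls ! j of (b, B, \<kappa>) \<Rightarrow> \<kappa> * B)"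
  define da where "da = (\<lambda>i. case us ! i of (a, A, \<kappa>) \<Rightarrow> \<kappa> * A)"
  have 1: "growth_bound (\<lambda>\<tau>. case ls ! j of (b, B, \<kappa>) \<Rightarrow> Gamma_pow L b B \<kappa> (Complex 0 \<tau>)) (eb j) (pi / 2 *
      db j)"
    if "j \<in> {..<m}" for j
  proof -
    obtain b B \<kappa> where j: "ls ! j = (b, B, \<kappa>)" by (cases "ls ! j")
    have p: "B > 0" "\<kappa> > 0" using ls[of j] that mn j by auto
    have "Re b \<notin> \<int>\<^sub>\<le>\<^sub>0"
      by (rule no_pole_on_contour[where C = B]) (use pl[of j] that j p in force)+
    from growth_bound_Gamma_pow[OF L _ p(2) this, of B] show ?thesis
      using p by (simp add: j eb_def db_def)
  qed
  have 2: "growth_bound (\<lambda>\<tau>. case us ! i of (a, A,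
      \<kappa>) \<Rightarrow> Gamma_pow L (1 - a) (- A) \<kappa> (Complex 0 \<tau>)) (ea i) (pi / 2 * da i)"
    if "i \<in> {..<n}" for i
  proof -
    obtain a A \<kappa> where i: "us ! i = (a, A, \<kappa>)" by (cases "us ! i")
    have p: "A > 0" "\<kappa> > 0" using us[of i] that mn i by auto
    have "Re (1 - a) \<notin> \<int>\<^sub>\<le>\<^sub>0"
      by (rule no_pole_on_contour[where C = "- A"]) (use pu[of i] that i p in force)+
    from growth_bound_Gamma_pow[OF L _ p(2) this, of "- A"] show ?thesis
      using p by (simp add: i ea_def da_def)
  qed
  have 3: "growth_bound (\<lambda>\<tau>. inverse (case ls ! j of (b, B,
      \<kappa>) \<Rightarrow> Gamma_pow L (1 - b) (- B) \<kappa> (Complex 0 \<tau>))) (eb j) (- (pi / 2 * db j))"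
    if "j \<in> {m..<length ls}" for j
  proof -
    obtain b B \<kappa> where j: "ls ! j = (b, B, \<kappa>)" by (cases "ls ! j")
    have p: "B > 0" "\<kappa> > 0" using ls[of j] that mn j by auto
    from growth_bound_inverse_Gamma_pow[OF L _ p(2), of "- B" "1 - b"] show ?thesis
      using p by (simp add: j eb_def db_def)
  qed
  have 4: "growth_bound (\<lambda>\<tau>. inverse (case us ! i of (a, A,
      \<kappa>) \<Rightarrow> Gamma_pow L a A \<kappa> (Complex 0 \<tau>))) (ea i) (- (pi / 2 * da i))"
    if "i \<in> {n..<length us}" for i
  proof -
    obtain a A \<kappa> where i: "us ! i = (a, A, \<kappa>)" by (cases "us ! i")
    have p: "A > 0" "\<kappa> > 0" using us[of i] that mn i by auto
    from growth_bound_inverse_Gamma_pow[OF L _ p(2), of A a] show ?thesis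
      using p by (simp add: i ea_def da_def)
  qed
  have K: "I_kernel L m n us ls s =
     ((\<Prod>j<m. case ls ! j of (b, B, \<kappa>) \<Rightarrow> Gamma_pow L b B \<kappa> s) *
      (\<Prod>i<n. case us ! i of (a, A, \<kappa>) \<Rightarrow> Gamma_pow L (1 - a) (- A) \<kappa> s)) *
     ((\<Prod>j\<in>{m..<length ls}. inverse (case ls ! j of (b, B, \<kappa>) \<Rightarrow> Gamma_pow L (1 - b) (- B) \<kappa> s)) *
      (\<Prod>i\<in>{n..<length us}. inverse (case us ! i of (a, A, \<kappa>) \<Rightarrow> Gamma_pow L a A \<kappa> s)))" for s
    unfolding I_kernel_def divide_inverse inverse_mult_distrib prod_inversef[symmetric] o_def ..
  have G: "growth_bound (\<lambda>\<tau>. I_kernel L m n us ls (Complex 0 \<tau>))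
      ((sum eb {..<m} + sum ea {..<n}) + (sum eb {m..<length ls} + sum ea {n..<length us}))
      (((\<Sum>j\<in>{..<m}. pi / 2 * db j) + (\<Sum>i\<in>{..<n}. pi / 2 * da i)) +
       ((\<Sum>j\<in>{m..<length ls}. - (pi / 2 * db j)) + (\<Sum>i\<in>{n..<length us}. - (pi / 2 * da i))))"
    unfolding K by (rule growth_bound_mult growth_bound_prod finite_lessThan finite_atLeastLessThan 1 2 3 4
        | assumption)+
  have split: "sum f {..<k} + sum f {k..<l} = sum f {..<l}" if "k \<le> l" for f :: "nat \<Rightarrow> real" and k l
    using that sum.atLeastLessThan_concat[of 0 k l f] by (simp add: atLeast0LessThan)
  have "(sum eb {..<m} + sum ea {..<n}) + (sum eb {m..<length ls} + sum ea {n..<length us})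
        = sum ea {..<length us} + sum eb {..<length ls}"
    using split[OF mn(1), of eb] split[OF mn(2), of ea] by simp
  also have "\<dots> = I_Omega us ls"
    unfolding I_Omega_def ea_def eb_def diff_conv_add_uminus[of "sum _ _" "sum _ _"] sum_negf[symmetric]
    by (intro arg_cong2[where f = "(+)"] sum.cong) (auto simp: algebra_simps split: prod.splits)
  finally have e: "(sum eb {..<m} + sum ea {..<n}) + (sum eb {m..<length ls} + sum ea {n..<length us}) =
      I_Omega us ls" .
  have d: "((\<Sum>j\<in>{..<m}. pi / 2 * db j) + (\<Sum>i\<in>{..<n}. pi / 2 * da i)) +
       ((\<Sum>j\<in>{m..<length ls}. - (pi / 2 * db j)) + (\<Sum>i\<in>{n..<length us}. - (pi / 2 * da i))) =
           pi / 2 * I_Delta m n us ls"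
    unfolding sum_negf sum_distrib_left[symmetric] I_Delta_def
    unfolding db_def[symmetric] da_def[symmetric] by (simp add: algebra_simps)
  show ?thesis using G unfolding e d .
qed

theorem integrable_I_kernel:
  assumes "Gamma_branches L" and "I_params m n us ls" and "I_abs_conv m n us ls \<theta>"
  shows "integrable lborel (\<lambda>\<tau>. I_kernel L m n us ls (Complex 0 \<tau>) * of_real (exp (\<theta> * \<tau>)))"
  using assms(3)
  by (intro integrable_growth_bound[OF growth_bound_I_kernel measurable_I_kernel] assms)
     (auto simp: I_abs_conv_def Let_def contour_abscissa_def)

section \<open>Differentiation of Mellin integrals\<close>

text \<open>
  The difference quotients are dominated by the Lipschitz bound \<open>B\<close>.
\<close>
lemma has_vector_derivative_integral_dominated:
  fixes g :: "real \<Rightarrow> 'a \<Rightarrow> 'b :: {banach, second_countable_topology}"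
  assumes S: "open S" "x \<in> S"
    and int: "\<And>y. y \<in> S \<Longrightarrow> integrable M (g y)"
    and meas: "g' \<in> borel_measurable M"
    and deriv: "\<And>t. ((\<lambda>y. g y t) has_vector_derivative g' t) (at x)"
    and lip: "\<And>y t. y \<in> S \<Longrightarrow> norm (g y t - g x t) \<le> B t * \<bar>y - x\<bar>"
    and B: "integrable M B"
  shows "((\<lambda>y. \<integral>t. g y t \<partial>M) has_vector_derivative (\<integral>t. g' t \<partial>M)) (at x)"
proof -
  have lim: "((\<lambda>y. (\<integral>t. g y t \<partial>M - \<integral>t. g x t \<partial>M) /\<^sub>R (y - x)) \<longlongrightarrow> (\<integral>t. g' t \<partial>M)) (at x within S)"
    unfolding tendsto_at_iff_sequentially
  proof (intro allI impI)
    fix X :: "nat \<Rightarrow> real" assume X: "\<forall>i. X i \<in> S - {x}" "X \<longlonglongrightarrow> x"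
    have "(\<lambda>n. \<integral>t. (g (X n) t - g x t) /\<^sub>R (X n - x) \<partial>M) \<longlonglongrightarrow> (\<integral>t. g' t \<partial>M)"
    proof (rule integral_dominated_convergence[OF meas _ B])
      show "(\<lambda>t. (g (X n) t - g x t) /\<^sub>R (X n - x)) \<in> borel_measurable M" for n
        using int[of "X n"] int[OF S(2)] X by (auto intro!: borel_measurable_scaleR borel_measurable_diff)
      show "AE t in M. (\<lambda>n. (g (X n) t - g x t) /\<^sub>R (X n - x)) \<longlonglongrightarrow> g' t"
      proof (rule AE_I2)
        fix t
        have "((\<lambda>y. norm (g y t - g x t - (y - x) *\<^sub>R g' t) / norm (y - x)) \<longlongrightarrow> 0) (at x)"
          using deriv[of t] by (simp add: has_vector_derivative_def has_derivative_iff_norm)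
        hence "((\<lambda>y. norm ((g y t - g x t) /\<^sub>R (y - x) - g' t)) \<longlongrightarrow> 0) (at x)"
        proof (rule Lim_transform_eventually)
          have "norm (g y t - g x t - (y - x) *\<^sub>R g' t) / norm (y - x) =
              norm ((g y t - g x t) /\<^sub>R (y - x) - g' t)"
            if "y \<noteq> x" for y
          proof -
            have "(g y t - g x t) /\<^sub>R (y - x) - g' t = (g y t - g x t - (y - x) *\<^sub>R g' t) /\<^sub>R (y - x)"
              using that by (simp add: scaleR_diff_right)
            thus ?thesis by (simp add: divide_inverse mult.commute abs_inverse)
          qed
          thus "\<forall>\<^sub>F y in at x. norm (g y t - g x t - (y - x) *\<^sub>R g' t) / norm (y - x) =
              norm ((g y t - g x t) /\<^sub>R (y - x) - g' t)"
            by (auto simp: eventually_at_filter)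
        qed
        hence "((\<lambda>y. (g y t - g x t) /\<^sub>R (y - x)) \<longlongrightarrow> g' t) (at x)"
          by (simp add: tendsto_norm_zero_iff LIM_zero_iff)
        thus "(\<lambda>n. (g (X n) t - g x t) /\<^sub>R (X n - x)) \<longlonglongrightarrow> g' t"
          using X unfolding tendsto_at_iff_sequentially by (auto simp: o_def)
      qed
      show "AE t in M. norm ((g (X n) t - g x t) /\<^sub>R (X n - x)) \<le> B t" for n
      proof (rule AE_I2)
        fix t
        have "\<bar>X n - x\<bar> > 0" using X by auto
        moreover have "norm ((g (X n) t - g x t) /\<^sub>R (X n - x)) = norm (g (X n) t - g x t) / \<bar>X n - x\<bar>"
          by (simp add: divide_inverse mult.commute abs_inverse)
        ultimately show "norm ((g (X n) t - g x t) /\<^sub>R (X n - x)) \<le> B t"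
          using lip[of "X n" t] X by (simp add: pos_divide_le_eq)
      qed
    qed
    also have "(\<lambda>n. \<integral>t. (g (X n) t - g x t) /\<^sub>R (X n - x) \<partial>M) =
        (\<lambda>y. (\<integral>t. g y t \<partial>M - \<integral>t. g x t \<partial>M) /\<^sub>R (y - x)) \<circ> X"
      using int S(2) X by (auto simp: fun_eq_iff Bochner_Integration.integral_diff)
    finally show "((\<lambda>y. (\<integral>t. g y t \<partial>M - \<integral>t. g x t \<partial>M) /\<^sub>R (y - x)) \<circ> X) \<longlonglongrightarrow> (\<integral>t. g' t \<partial>M)" .
  qed
  define F where "F = (\<lambda>y. \<integral>t. g y t \<partial>M)"
  define D where "D = (\<integral>t. g' t \<partial>M)"
  have "((\<lambda>y. (F y - F x) /\<^sub>R (y - x)) \<longlongrightarrow> D) (at x)"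
    using lim at_within_open[OF S(2,1)] by (simp add: F_def D_def)
  hence "((\<lambda>y. norm ((F y - F x) /\<^sub>R (y - x) - D)) \<longlongrightarrow> 0) (at x)"
    by (simp add: tendsto_norm_zero_iff LIM_zero_iff)
  hence "((\<lambda>y. norm (F y - F x - (y - x) *\<^sub>R D) / norm (y - x)) \<longlongrightarrow> 0) (at x)"
  proof (rule Lim_transform_eventually)
    have "norm ((F y - F x) /\<^sub>R (y - x) - D) = norm (F y - F x - (y - x) *\<^sub>R D) / norm (y - x)"
      if "y \<noteq> x" for y
    proof -
      have "(F y - F x) /\<^sub>R (y - x) - D = (F y - F x - (y - x) *\<^sub>R D) /\<^sub>R (y - x)"
        using that by (simp add: scaleR_diff_right)
      thus ?thesis by (simp add: divide_inverse mult.commute abs_inverse)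
    qed
    thus "\<forall>\<^sub>F y in at x. norm ((F y - F x) /\<^sub>R (y - x) - D) =
        norm (F y - F x - (y - x) *\<^sub>R D) / norm (y - x)"
      by (auto simp: eventually_at_filter)
  qed
  thus ?thesis unfolding F_def[symmetric] D_def[symmetric]
    by (simp add: has_vector_derivative_def has_derivative_iff_norm bounded_linear_scaleR_left)
qed

lemma has_vector_derivative_of_real_powr:
  assumes "x > 0"
  shows "((\<lambda>y. of_real y powr s :: complex) has_vector_derivative s * of_real x powr (s - 1)) (at x)"
  using assms by (intro has_vector_derivative_real_field) (auto intro!: derivative_eq_intros)

text \<open>
  The mean value inequality for \<open>\<xi> \<mapsto> \<xi>\<^bsup>s\<^esup>\<close>; its constant depends on \<open>s\<close> only through \<open>\<bar>s\<bar>\<close> and \<open>Re s\<close>, and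
  the latter is constant along a vertical line.
\<close>
lemma norm_powr_diff_le:
  fixes s :: complex
  assumes "0 < l" "l \<le> x" "x \<le> u" "l \<le> y" "y \<le> u" and B: "\<And>\<xi>. l \<le> \<xi> \<Longrightarrow> \<xi> \<le> u \<Longrightarrow> \<xi> powr (Re s - 1) \<le> B"
  shows "cmod (of_real y powr s - of_real x powr s) \<le> cmod s * B * \<bar>y - x\<bar>"
proof -
  have "norm (complex_of_real y powr s - of_real x powr s) \<le>
      cmod s * B * norm (complex_of_real y - of_real x)"
  proof (rule field_differentiable_bound[where S = "complex_of_real ` {l..u}"])
    show "convex (complex_of_real ` {l..u})"
      by (intro convex_linear_image convex_real_interval bounded_linear.linear bounded_linear_of_real)
    fix z assume "z \<in> complex_of_real ` {l..u}"
    then obtain \<xi> where \<xi>: "z = of_real \<xi>" "l \<le> \<xi>" "\<xi> \<le> u" by auto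
    show "((\<lambda>z. z powr s) has_field_derivative s * z powr (s - 1)) (at z within complex_of_real ` {l..u})"
      using \<xi> assms(1) by (auto intro!: derivative_eq_intros)
    have "cmod (s * z powr (s - 1)) = cmod s * \<xi> powr (Re s - 1)"
      using \<xi> assms(1) by (simp add: norm_mult norm_of_real_powr)
    also have "\<dots> \<le> cmod s * B" using B \<xi> by (intro mult_left_mono) auto
    finally show "cmod (s * z powr (s - 1)) \<le> cmod s * B" .
  qed (use assms in auto)
  thus ?thesis by (simp flip: of_real_diff)
qed

lemma borel_measurable_powr_exponent:
  assumes "x > 0" and [measurable]: "s \<in> borel_measurable M"
  shows "(\<lambda>\<tau>. complex_of_real x powr s \<tau>) \<in> borel_measurable M"
  using assms(1) by (simp add: of_real_powr_conv_exp)

lemma has_vector_derivative_mellin_integral: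
  fixes \<phi> :: "real \<Rightarrow> complex" and w :: complex and \<mu> x :: real
  assumes \<phi>: "integrable lborel \<phi>" and w\<phi>: "integrable lborel (\<lambda>\<tau>. \<phi> \<tau> * (w - \<i> * of_real (\<mu> *
      \<tau>)))" and x: "x > 0"
  shows "((\<lambda>y. \<integral>\<tau>. \<phi> \<tau> * of_real y powr (w - \<i> * of_real (\<mu> * \<tau>)) \<partial>lborel) has_vector_derivative
           (\<integral>\<tau>. \<phi> \<tau> * (w - \<i> * of_real (\<mu> * \<tau>)) * of_real x powr (w - 1 - \<i> * of_real (\<mu> *
               \<tau>)) \<partial>lborel)) (at x)"
proof -
  define s where "s = (\<lambda>\<tau>. w - \<i> * of_real (\<mu> * \<tau>))"
  have [measurable]: "\<phi> \<in> borel_measurable borel" using \<phi> by simp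
  have ms [measurable]: "s \<in> borel_measurable borel" unfolding s_def by measurable
  have Re_s: "Re (s \<tau>) = Re w" for \<tau> by (simp add: s_def)
  have s1: "w - 1 - \<i> * of_real (\<mu> * \<tau>) = s \<tau> - 1" for \<tau> by (simp add: s_def)
  \<comment> \<open>any compact neighbourhood of \<open>x\<close> inside \<open>(0, \<infinity>)\<close> would do\<close>
  have "continuous_on {x/2..2*x} (\<lambda>\<xi>. \<xi> powr (Re w - 1))"
    using x by (intro continuous_intros) auto
  hence "bounded ((\<lambda>\<xi>. \<xi> powr (Re w - 1)) ` {x/2..2*x})"
    by (intro compact_imp_bounded compact_continuous_image) auto
  then obtain B where B: "\<And>\<xi>. \<xi> \<in> {x/2..2*x} \<Longrightarrow> norm (\<xi> powr (Re w - 1)) \<le> B"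
    unfolding bounded_iff by blast
  have s0: "w - \<i> * of_real (\<mu> * \<tau>) = s \<tau>" for \<tau> by (simp add: s_def)
  show ?thesis unfolding s0 s1
  proof (rule has_vector_derivative_integral_dominated[where S = "{x/2<..<2*x}" and B =
      "\<lambda>\<tau>. cmod (\<phi> \<tau> * s \<tau>) * B"])
    show "x \<in> {x/2<..<2*x}" using x by auto
    fix y assume y: "y \<in> {x/2<..<2*x}"
    hence y0: "y > 0" using x by auto
    note [measurable] = borel_measurable_powr_exponent[OF y0 ms]
    show "integrable lborel (\<lambda>\<tau>. \<phi> \<tau> * of_real y powr s \<tau>)"
    proof (rule Bochner_Integration.integrable_bound)
      show "integrable lborel (\<lambda>\<tau>. cmod (\<phi> \<tau>) * y powr Re w)" using \<phi> by simp
      show "AE \<tau> in lborel. norm (\<phi> \<tau> * of_real y powr s \<tau>) \<le> norm (cmod (\<phi> \<tau>) * y powr Re w)"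
        using y0 by (auto intro!: AE_I2 simp: norm_mult norm_of_real_powr Re_s)
    qed measurable
    fix \<tau>
    have "cmod (of_real y powr s \<tau> - of_real x powr s \<tau>) \<le> cmod (s \<tau>) * B * \<bar>y - x\<bar>"
      by (rule norm_powr_diff_le[where l = "x/2" and u = "2*x"]) (use x y B Re_s in auto)
    hence "cmod (\<phi> \<tau>) * cmod (of_real y powr s \<tau> - of_real x powr s \<tau>) \<le> cmod (\<phi> \<tau>) * (cmod (s \<tau>) * B *
        \<bar>y - x\<bar>)"
      by (rule mult_left_mono) simp
    thus "cmod (\<phi> \<tau> * of_real y powr s \<tau> - \<phi> \<tau> * of_real x powr s \<tau>) \<le> cmod (\<phi> \<tau> * s \<tau>) * B * \<bar>y - x\<bar>"
      by (simp add: norm_mult mult_ac flip: right_diff_distrib)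
  next
    note [measurable] = borel_measurable_powr_exponent[OF x, of "\<lambda>\<tau>. s \<tau> - 1"]
    show "(\<lambda>\<tau>. \<phi> \<tau> * s \<tau> * of_real x powr (s \<tau> - 1)) \<in> borel_measurable lborel" by measurable
    show "((\<lambda>y. \<phi> \<tau> * of_real y powr s \<tau>) has_vector_derivative
        \<phi> \<tau> * s \<tau> * of_real x powr (s \<tau> - 1)) (at x)" for \<tau>
      using has_vector_derivative_mult_right[OF has_vector_derivative_of_real_powr[OF x, of "s \<tau>"],
          of "\<phi> \<tau>"]
      by (simp add: mult.assoc)
    show "integrable lborel (\<lambda>\<tau>. cmod (\<phi> \<tau> * s \<tau>) * B)" using w\<phi> unfolding s0 by simp
  qed auto
qed

text \<open>
  The formula for the \<open>k\<close>-th derivative holds on all of \<open>(0, \<infinity>)\<close>, so that it can be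
  differentiated again.
\<close>
lemma iter_deriv_mellin_integral:
  fixes P :: "nat \<Rightarrow> real \<Rightarrow> complex"
  assumes int: "\<And>k. k \<le> N \<Longrightarrow> integrable lborel (P k)"
    and rec: "\<And>k \<tau>. k < N \<Longrightarrow> P (Suc k) \<tau> = P k \<tau> * (w - of_nat k - \<i> * of_real (\<mu> * \<tau>))"
    and g: "\<And>y. y > 0 \<Longrightarrow> g y = (\<integral>\<tau>. P 0 \<tau> * of_real y powr (w - \<i> * of_real (\<mu> * \<tau>)) \<partial>lborel)"
  shows "k \<le> N \<Longrightarrow> x > 0 \<Longrightarrow>
           iter_deriv k g x = (\<integral>\<tau>. P k \<tau> * of_real x powr (w - of_nat k - \<i> * of_real (\<mu> * \<tau>)) \<partial>lborel)"
    and "k < N \<Longrightarrow> x > 0 \<Longrightarrow> iter_deriv k g differentiable (at x)"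
proof -
  define F where "F = (\<lambda>k y. \<integral>\<tau>. P k \<tau> * of_real y powr (w - of_nat k - \<i> * of_real (\<mu> * \<tau>)) \<partial>lborel)"
  have dF: "(F k has_vector_derivative F (Suc k) x) (at x)" if "k < N" "x > 0" for k x
  proof -
    have "integrable lborel (\<lambda>\<tau>. P k \<tau> * (w - of_nat k - \<i> * of_real (\<mu> * \<tau>)))"
      using int[of "Suc k"] that unfolding rec[OF that(1), symmetric] by simp
    from has_vector_derivative_mellin_integral[OF int this that(2)] that
    have "(F k has_vector_derivative (\<integral>\<tau>. P k \<tau> * (w - of_nat k - \<i> * of_real (\<mu> * \<tau>)) *
        of_real x powr (w - of_nat k - 1 - \<i> * of_real (\<mu> * \<tau>)) \<partial>lborel)) (at x)"
      by (simp add: F_def)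
    also have "(\<integral>\<tau>. P k \<tau> * (w - of_nat k - \<i> * of_real (\<mu> * \<tau>)) * of_real x powr (w - of_nat k - 1 - \<i> *
        of_real (\<mu> * \<tau>)) \<partial>lborel) = F (Suc k) x"
      unfolding F_def rec[OF that(1)] by (simp add: algebra_simps)
    finally show ?thesis .
  qed
  have transfer: "(iter_deriv k g has_vector_derivative F (Suc k) x) (at x)"
    if eq: "\<And>y. y > 0 \<Longrightarrow> iter_deriv k g y = F k y" and "k < N" "x > 0" for k x
    by (rule has_vector_derivative_transform_within_open[OF dF[OF that(2,3)], of "{0<..}"])
       (use that in auto)
  have main: "\<And>x. x > 0 \<Longrightarrow> iter_deriv k g x = F k x" if "k \<le> N" for k
    using that
  proof (induction k)
    case 0
    thus ?case by (simp add: iter_deriv_def F_def g)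
  next
    case (Suc k)
    have "iter_deriv (Suc k) g x = vector_derivative (iter_deriv k g) (at x)" by (simp add: iter_deriv_def)
    also have "\<dots> = F (Suc k) x"
      using Suc by (intro vector_derivative_at transfer) auto
    finally show ?case .
  qed
  show "k \<le> N \<Longrightarrow> x > 0 \<Longrightarrow>
      iter_deriv k g x = (\<integral>\<tau>. P k \<tau> * of_real x powr (w - of_nat k - \<i> * of_real (\<mu> * \<tau>)) \<partial>lborel)"
    using main unfolding F_def by blast
  show "k < N \<Longrightarrow> x > 0 \<Longrightarrow> iter_deriv k g differentiable (at x)"
    by (rule differentiableI_vector[OF transfer]) (auto simp: main)
qed

section \<open>The Saigo integral of a Mellin integral\<close>

text \<open>
  The Saigo integral maps \<open>t\<^bsup>\<sigma>-1\<^esup>\<close> to this multiple of \<open>x\<^bsup>\<sigma>-\<beta>-1\<^esup>\<close>.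
\<close>
definition saigo_multiplier :: "complex \<Rightarrow> complex \<Rightarrow> complex \<Rightarrow> complex \<Rightarrow> complex" where
  "saigo_multiplier \<alpha> \<beta> \<gamma> \<sigma> =
     Gamma \<sigma> * Gamma (\<sigma> + \<gamma> - \<beta>) * rGamma (\<sigma> - \<beta>) * rGamma (\<sigma> + \<alpha> + \<gamma>)"

text \<open>
  After the substitution \<open>t = x (1 - u)\<close> the double integrand is \<open>W(u) \<psi>(\<tau>)\<close> times a factor of modulus
  \<open>1\<close>, with \<open>W\<close> and \<open>\<psi>\<close> integrable, so Fubini's theorem applies.  The inner integral over \<open>u\<close> is the
  hypergeometric Beta integral with \<open>\<sigma> = \<rho> - \<i> \<mu> \<tau>\<close>, whose real part does not depend on \<open>\<tau>\<close>.
\<close>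
theorem saigo_integral_mellin_integral:
  fixes \<phi> :: "real \<Rightarrow> complex" and \<alpha> \<beta> \<gamma> \<rho> :: complex and \<mu> x :: real
  assumes \<phi>: "integrable lborel \<phi>" and \<alpha>: "Re \<alpha> > 0" and \<rho>: "Re \<rho> > 0" and conv: "Re (\<rho> +
      \<gamma> - \<beta>) > 0" and x: "x > 0"
    and f: "\<And>t. t > 0 \<Longrightarrow> f t = of_real t powr (\<rho> - 1) * (\<integral>\<tau>. \<phi> \<tau> * of_real t powr (- \<i> * of_real (\<mu> *
        \<tau>)) \<partial>lborel)"
  shows "set_integrable lborel {0<..<x} (saigo_integrand \<alpha> \<beta> \<gamma> f x)"
    and "saigo_integral \<alpha> \<beta> \<gamma> f x =
      (\<integral>\<tau>. \<phi> \<tau> * saigo_multiplier \<alpha> \<beta> \<gamma> (\<rho> - \<i> * of_real (\<mu> * \<tau>)) * of_real x powr (\<rho> - \<beta> - 1 - \<i> *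
          of_real (\<mu> * \<tau>)) \<partial>lborel)"
proof -
  define W where "W = (\<lambda>u. indicator {0<..<1} u *\<^sub>R (of_real u powr (\<alpha> - 1) * of_real (1 - u) powr (\<rho> - 1) *
      hyp2F1 (\<alpha> + \<beta>) (- \<gamma>) \<alpha> (of_real u)))"
  define \<psi> where "\<psi> = (\<lambda>\<tau>. \<phi> \<tau> * exp (- \<i> * of_real (\<mu> * \<tau> * ln x)))"
  define G where "G = (\<lambda>u \<tau>. W u * \<psi> \<tau> * exp (- \<i> * of_real (\<mu> * \<tau> * ln (1 - u))))"
  define c where "c = of_real x powr (\<alpha> + \<rho> - 2)"
  have W: "integrable lborel W"
    using hypergeometric_Beta_integral(1)[of \<alpha> \<rho> "\<alpha> + \<beta>" "- \<gamma>"] \<alpha> \<rho> conv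
    by (simp add: W_def set_integrable_def algebra_simps)
  have [measurable]: "W \<in> borel_measurable borel" "\<phi> \<in> borel_measurable borel" using W \<phi> by auto
  have [measurable]: "\<psi> \<in> borel_measurable borel" unfolding \<psi>_def by measurable
  have norm\<psi>: "cmod (\<psi> \<tau>) = cmod (\<phi> \<tau>)" for \<tau> by (simp add: \<psi>_def norm_mult)
  have normG: "cmod (G u \<tau>) = cmod (W u) * cmod (\<phi> \<tau>)" for u \<tau> by (simp add: G_def norm_mult norm\<psi>)
  have G: "integrable (lborel \<Otimes>\<^sub>M lborel) (\<lambda>(u, \<tau>). G u \<tau>)"
  proof (rule lborel_pair.Fubini_integrable)
    show "(\<lambda>(u, \<tau>). G u \<tau>) \<in> borel_measurable (lborel \<Otimes>\<^sub>M lborel)" unfolding G_def by measurable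
    show "integrable lborel (\<lambda>u. \<integral>\<tau>. norm (case (u, \<tau>) of (u, \<tau>) \<Rightarrow> G u \<tau>) \<partial>lborel)"
      using W by (simp add: normG)
    have "integrable lborel (G u)" for u
    proof (rule Bochner_Integration.integrable_bound)
      show "integrable lborel (\<lambda>\<tau>. cmod (W u) * cmod (\<phi> \<tau>))" using \<phi> by simp
      show "G u \<in> borel_measurable lborel" unfolding G_def by measurable
    qed (auto simp: normG)
    thus "AE u in lborel. integrable lborel (\<lambda>\<tau>. case (u, \<tau>) of (u, \<tau>) \<Rightarrow> G u \<tau>)" by simp
  qed
  have sub: "indicator {0<..<x} (x + (- x) * u) *\<^sub>R saigo_integrand \<alpha> \<beta> \<gamma> f x (x + (- x) * u) =
      c * (\<integral>\<tau>. G u \<tau> \<partial>lborel)" for u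
  proof (cases "u \<in> {0<..<1}")
    case False
    hence "x + (- x) * u \<notin> {0<..<x}" using x
        by (auto simp: mult_less_0_iff zero_less_mult_iff algebra_simps)
    thus ?thesis using False by (simp add: G_def W_def)
  next
    case True
    define t where "t = x * (1 - u)"
    have t: "x + (- x) * u = t" "t > 0" "t < x" using True x by (auto simp: t_def algebra_simps)
    have lt: "ln t = ln x + ln (1 - u)" using True x by (simp add: t_def ln_mult)
    have xt: "x - t = x * u" "1 - t / x = u" using x by (auto simp: t_def algebra_simps divide_simps)
    have "of_real t powr (- \<i> * of_real (\<mu> * \<tau>)) =
        exp (- \<i> * of_real (\<mu> * \<tau> * ln x)) * exp (- \<i> * of_real (\<mu> * \<tau> * ln (1 - u)))" for \<tau>
      using t by (simp add: of_real_powr_conv_exp lt algebra_simps flip: exp_add)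
    hence ft: "f t = of_real t powr (\<rho> - 1) * (\<integral>\<tau>. \<psi> \<tau> * exp (- \<i> * of_real (\<mu> * \<tau> * ln (1 - u))) \<partial>lborel)"
      unfolding f[OF t(2)] \<psi>_def by (simp add: mult.assoc)
    have "(\<integral>\<tau>. G u \<tau> \<partial>lborel) = W u * (\<integral>\<tau>. \<psi> \<tau> * exp (- \<i> * of_real (\<mu> * \<tau> * ln (1 - u))) \<partial>lborel)"
      unfolding G_def mult.assoc by simp
    moreover have "of_real (x * u) powr (\<alpha> - 1) = of_real x powr (\<alpha> - 1) * complex_of_real u powr (\<alpha> - 1)"
      "of_real t powr (\<rho> - 1) = of_real x powr (\<rho> - 1) * complex_of_real (1 - u) powr (\<rho> - 1)"
      unfolding t_def of_real_mult using x True by (intro powr_times_real; simp)+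
    moreover have "c = of_real x powr (\<alpha> - 1) * of_real x powr (\<rho> - 1)"
      unfolding c_def powr_add[symmetric] by (simp add: algebra_simps)
    ultimately show ?thesis using True t(2,3)
      unfolding t(1) saigo_integrand_def ft xt by (simp add: W_def mult_ac)
  qed
  have "integrable lborel (\<lambda>u. c * (\<integral>\<tau>. G u \<tau> \<partial>lborel))"
    using lborel_pair.integrable_fst'[OF G] by simp
  thus "set_integrable lborel {0<..<x} (saigo_integrand \<alpha> \<beta> \<gamma> f x)"
    unfolding set_integrable_def sub[symmetric]
    by (subst (asm) lborel_integrable_real_affine_iff) (use x in auto)
  have inner: "(\<integral>u. G u \<tau> \<partial>lborel) = \<psi> \<tau> * (Gamma \<alpha> * saigo_multiplier \<alpha> \<beta> \<gamma> (\<rho> - \<i> * of_real (\<mu> * \<tau>)))"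
      for \<tau>
  proof -
    define \<sigma> where "\<sigma> = \<rho> - \<i> * of_real (\<mu> * \<tau>)"
    have "(\<integral>u. G u \<tau> \<partial>lborel) = (\<integral>u. \<psi> \<tau> * (indicator {0<..<1} u *\<^sub>R (of_real u powr (\<alpha> - 1) *
        of_real (1 - u) powr (\<sigma> - 1) * hyp2F1 (\<alpha> + \<beta>) (- \<gamma>) \<alpha> (of_real u))) \<partial>lborel)"
    proof (rule Bochner_Integration.integral_cong[OF refl])
      fix u :: real
      show "G u \<tau> = \<psi> \<tau> * (indicator {0<..<1} u *\<^sub>R (of_real u powr (\<alpha> - 1) * of_real (1 - u) powr (\<sigma> - 1) *
          hyp2F1 (\<alpha> + \<beta>) (- \<gamma>) \<alpha> (of_real u)))"
      proof (cases "u \<in> {0<..<1}")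
        case True
        have "of_real (1 - u) powr (\<sigma> - 1) = of_real (1 - u) powr (\<rho> - 1) * exp (- \<i> * of_real (\<mu> * \<tau> *
            ln (1 - u)))"
          using True unfolding \<sigma>_def
          by (subst (1 2) of_real_powr_conv_exp) (auto simp: algebra_simps simp flip: exp_add)
        thus ?thesis using True by (simp add: G_def W_def mult_ac del: of_real_diff)
      qed (simp add: G_def W_def)
    qed
    also have "\<dots> = \<psi> \<tau> * (CLINT u:{0<..<1}|lborel. of_real u powr (\<alpha> - 1) * of_real (1 - u) powr (\<sigma> - 1) *
        hyp2F1 (\<alpha> + \<beta>) (- \<gamma>) \<alpha> (of_real u))"
      unfolding set_lebesgue_integral_def by (rule integral_mult_right_zero)
    also have "(CLINT u:{0<..<1}|lborel. of_real u powr (\<alpha> - 1) * of_real (1 - u) powr (\<sigma> - 1) * hyp2F1 (\<alpha> +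
        \<beta>) (- \<gamma>) \<alpha> (of_real u)) =
       Gamma \<alpha> * Gamma \<sigma> * Gamma (\<alpha> + \<sigma> - (\<alpha> + \<beta>) - (- \<gamma>)) * rGamma (\<alpha> + \<sigma> - (\<alpha> + \<beta>)) * rGamma (\<alpha> +
           \<sigma> - (- \<gamma>))"
      using \<alpha> \<rho> conv by (intro hypergeometric_Beta_integral(2)) (auto simp: \<sigma>_def)
    also have "\<dots> = Gamma \<alpha> * saigo_multiplier \<alpha> \<beta> \<gamma> \<sigma>"
      unfolding saigo_multiplier_def by (simp add: algebra_simps)
    finally show ?thesis unfolding \<sigma>_def .
  qed
  have G0: "Gamma \<alpha> \<noteq> 0" using not_nonpos_Int_Re_pos[OF \<alpha>] by (simp add: Gamma_eq_zero_iff)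
  have "(CLINT t:{0<..<x}|lborel. saigo_integrand \<alpha> \<beta> \<gamma> f x t) =
      of_real x * (\<integral>u. c * (\<integral>\<tau>. G u \<tau> \<partial>lborel) \<partial>lborel)"
    unfolding set_lebesgue_integral_def sub[symmetric]
    by (subst lborel_integral_real_affine[of "- x" _ x]) (use x in \<open>auto simp: scaleR_conv_of_real\<close>)
  also have "\<dots> = of_real x * c * (\<integral>u. \<integral>\<tau>. G u \<tau> \<partial>lborel \<partial>lborel)" by simp
  also have "(\<integral>u. \<integral>\<tau>. G u \<tau> \<partial>lborel \<partial>lborel) = (\<integral>\<tau>. \<integral>u. G u \<tau> \<partial>lborel \<partial>lborel)"
    by (rule lborel_pair.Fubini_integral[OF G, symmetric])
  also have "\<dots> = (\<integral>\<tau>. \<psi> \<tau> * (Gamma \<alpha> * saigo_multiplier \<alpha> \<beta> \<gamma> (\<rho> - \<i> * of_real (\<mu> * \<tau>))) \<partial>lborel)"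
    by (simp only: inner)
  finally have "saigo_integral \<alpha> \<beta> \<gamma> f x = of_real x powr (- \<alpha> - \<beta>) / Gamma \<alpha> * (of_real x * c *
      (\<integral>\<tau>. \<psi> \<tau> * (Gamma \<alpha> * saigo_multiplier \<alpha> \<beta> \<gamma> (\<rho> - \<i> * of_real (\<mu> * \<tau>))) \<partial>lborel))"
    unfolding saigo_integral_def by simp
  also have "\<dots> = (\<integral>\<tau>. of_real x powr (- \<alpha> - \<beta>) / Gamma \<alpha> * (of_real x * c *
       (\<psi> \<tau> * (Gamma \<alpha> * saigo_multiplier \<alpha> \<beta> \<gamma> (\<rho> - \<i> * of_real (\<mu> * \<tau>))))) \<partial>lborel)"
    by (simp only: integral_mult_right_zero)
  also have "\<dots> = (\<integral>\<tau>. \<phi> \<tau> * saigo_multiplier \<alpha> \<beta> \<gamma> (\<rho> - \<i> * of_real (\<mu> * \<tau>)) *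
      of_real x powr (\<rho> - \<beta> - 1 - \<i> * of_real (\<mu> * \<tau>)) \<partial>lborel)"
  proof (rule Bochner_Integration.integral_cong[OF refl])
    fix \<tau> :: real
    have "of_real x powr (- \<alpha> - \<beta>) * (of_real x powr 1 * of_real x powr (\<alpha> + \<rho> - 2)) * of_real x powr (- \<i> *
        of_real (\<mu> * \<tau>)) =
        of_real x powr (\<rho> - \<beta> - 1 - \<i> * of_real (\<mu> * \<tau>))"
      unfolding powr_add[symmetric] by (rule arg_cong[where f = "(powr) _"]) (simp add: algebra_simps)
    moreover have "of_real x powr (- \<i> * of_real (\<mu> * \<tau>)) = exp (- \<i> * of_real (\<mu> * \<tau> * ln x))"
      using x by (simp add: of_real_powr_conv_exp mult_ac)
    ultimately have "of_real x powr (\<rho> - \<beta> - 1 - \<i> * of_real (\<mu> * \<tau>)) =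
        of_real x powr (- \<alpha> - \<beta>) * (of_real x * c) * exp (- \<i> * of_real (\<mu> * \<tau> * ln x))"
      using x by (simp add: c_def)
    thus "of_real x powr (- \<alpha> - \<beta>) / Gamma \<alpha> * (of_real x * c *
       (\<psi> \<tau> * (Gamma \<alpha> * saigo_multiplier \<alpha> \<beta> \<gamma> (\<rho> - \<i> * of_real (\<mu> * \<tau>))))) =
       \<phi> \<tau> * saigo_multiplier \<alpha> \<beta> \<gamma> (\<rho> - \<i> * of_real (\<mu> * \<tau>)) * of_real x powr (\<rho> - \<beta> - 1 - \<i> * of_real (\<mu> *
           \<tau>))"
      using G0 by (simp add: \<psi>_def mult_ac)
  qed
  finally show "saigo_integral \<alpha> \<beta> \<gamma> f x =
      (\<integral>\<tau>. \<phi> \<tau> * saigo_multiplier \<alpha> \<beta> \<gamma> (\<rho> - \<i> * of_real (\<mu> * \<tau>)) * of_real x powr (\<rho> - \<beta> - 1 - \<i> *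
          of_real (\<mu> * \<tau>)) \<partial>lborel)" .
qed

section \<open>The Saigo derivative of the I-function\<close>

text \<open>
  The part of the integrand of \<open>I(a t\<^bsup>\<mu>\<^esup>)\<close> at \<open>s = \<i> \<tau>\<close> that does not depend on \<open>t\<close>; the other one
  is \<open>t\<^bsup>- \<i> \<mu> \<tau>\<^esup>\<close>.  The constant is \<open>1 / (2 \<pi>)\<close>, the factor \<open>\<i>\<close> of \<open>ds = \<i> d\<tau>\<close> having been cancelled.
\<close>
definition I_density :: "branches \<Rightarrow> nat \<Rightarrow> nat \<Rightarrow> triple list \<Rightarrow> triple list \<Rightarrow> complex \<Rightarrow> real \<Rightarrow> real \<Rightarrow> complex"
    where
  "I_density L m n us ls a \<theta> \<tau> =
     I_kernel L m n us ls (Complex 0 \<tau>) * of_real (exp (\<theta> * \<tau>)) * (exp (- \<i> * of_real (\<tau> *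
         ln (cmod a))) / of_real (2 * pi))"

lemma I_function_monomial:
  assumes "a \<noteq> 0" "t > 0"
  shows "I_function L m n us ls (a * of_real (t powr \<mu>)) \<theta> =
           (\<integral>\<tau>. I_density L m n us ls a \<theta> \<tau> * of_real t powr (- \<i> * of_real (\<mu> * \<tau>)) \<partial>lborel)"
proof -
  have ln: "ln (cmod (a * of_real (t powr \<mu>))) = ln (cmod a) + \<mu> * ln t"
    using assms by (simp add: norm_mult ln_mult ln_powr)
  have "exp (- Complex 0 \<tau> * (of_real (ln (cmod a) + \<mu> * ln t) + \<i> * of_real \<theta>)) =
      of_real (exp (\<theta> * \<tau>)) * exp (- \<i> * of_real (\<tau> * ln (cmod a))) * of_real t powr (- \<i> * of_real (\<mu> *
          \<tau>))" for \<tau>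
  proof -
    have "- Complex 0 \<tau> * (of_real (ln (cmod a) + \<mu> * ln t) + \<i> * of_real \<theta>) =
        of_real (\<theta> * \<tau>) + - \<i> * of_real (\<tau> * ln (cmod a)) + - \<i> * of_real (\<mu> * \<tau>) * of_real (ln t)"
      by (simp add: complex_eq_iff algebra_simps)
    thus ?thesis using assms(2) by (simp only: exp_add of_real_powr_conv_exp exp_of_real)
  qed
  hence "I_kernel L m n us ls (Complex 0 \<tau>) * exp (- Complex 0 \<tau> * (of_real (ln (cmod a) + \<mu> * ln t) + \<i> *
      of_real \<theta>)) * \<i> =
      2 * of_real pi * \<i> * (I_density L m n us ls a \<theta> \<tau> * of_real t powr (- \<i> * of_real (\<mu> * \<tau>)))" for \<tau>
    by (simp add: I_density_def)
  thus ?thesis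
    unfolding I_function_def contour_abscissa_def Let_def ln by simp
qed

lemma integrable_I_density:
  assumes "Gamma_branches L" and "I_params m n us ls" and "I_abs_conv m n us ls \<theta>"
  shows "integrable lborel (I_density L m n us ls a \<theta>)"
proof (rule Bochner_Integration.integrable_bound[OF integrable_I_kernel[OF assms]])
  have [measurable]: "(\<lambda>\<tau>. I_kernel L m n us ls (Complex 0 \<tau>) * of_real (exp (\<theta> * \<tau>))) \<in>
      borel_measurable lborel"
    using integrable_I_kernel[OF assms] by (rule borel_measurable_integrable)
  show "I_density L m n us ls a \<theta> \<in> borel_measurable lborel" unfolding I_density_def by measurable
  have "1 \<le> 2 * pi" using pi_ge_two by simp
  hence "c / (2 * pi) \<le> c" if "c \<ge> 0" for c :: real
    using that mult_left_mono[of 1 "2 * pi" c] by (simp add: divide_simps)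
  thus "AE \<tau> in lborel. norm (I_density L m n us ls a \<theta> \<tau>) \<le> norm (I_kernel L m n us ls (Complex 0 \<tau>) *
      of_real (exp (\<theta> * \<tau>)))"
    by (auto intro!: AE_I2 simp: I_density_def norm_mult norm_divide)
qed

lemma I_kernel_extend:
  assumes L: "Gamma_branches L" and s: "Re s = 0" and m: "m \<le> length ls"
  shows "I_kernel L m (n + 2) ([(c1, \<mu>, 1), (c2, \<mu>, 1)] @ us) (ls @ [(d1, \<mu>, 1), (d2, \<mu>, 1)]) s =
    I_kernel L m n us ls s *
    (Gamma (1 - c1 - of_real \<mu> * s) * Gamma (1 - c2 - of_real \<mu> * s) *
     rGamma (1 - d1 - of_real \<mu> * s) * rGamma (1 - d2 - of_real \<mu> * s))"
proof -
  define P1 where "P1 = (\<Prod>j<m. case ls ! j of (b, B, \<kappa>) \<Rightarrow> Gamma_pow L b B \<kappa> s)"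
  define P2 where "P2 = (\<Prod>i<n. case us ! i of (a, A, \<kappa>) \<Rightarrow> Gamma_pow L (1 - a) (- A) \<kappa> s)"
  define P3 where "P3 = (\<Prod>j\<in>{m..<length ls}. case ls ! j of (b, B, \<kappa>) \<Rightarrow> Gamma_pow L (1 - b) (- B) \<kappa> s)"
  define P4 where "P4 = (\<Prod>i\<in>{n..<length us}. case us ! i of (a, A, \<kappa>) \<Rightarrow> Gamma_pow L a A \<kappa> s)"
  let ?us = "[(c1, \<mu>, 1), (c2, \<mu>, 1)] @ us" and ?ls = "ls @ [(d1, \<mu>, 1), (d2, \<mu>, 1)]"
  have G: "Gamma_pow L (1 - c) (- \<mu>) 1 s = Gamma (1 - c - of_real \<mu> * s)" for c
    using Gamma_pow_one[OF L s, of "1 - c" "- \<mu>"] by simp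
  have 1: "(\<Prod>j<m. case ?ls ! j of (b, B, \<kappa>) \<Rightarrow> Gamma_pow L b B \<kappa> s) = P1"
    unfolding P1_def using m by (intro prod.cong) (auto simp: nth_append)
  have 2: "(\<Prod>i<n+2. case ?us ! i of (a, A, \<kappa>) \<Rightarrow> Gamma_pow L (1 - a) (- A) \<kappa> s) =
      Gamma (1 - c1 - of_real \<mu> * s) * (Gamma (1 - c2 - of_real \<mu> * s) * P2)"
    unfolding P2_def by (simp add: prod.lessThan_Suc_shift G del: prod.lessThan_Suc)
  have 3: "(\<Prod>j\<in>{m..<length ?ls}. case ?ls ! j of (b, B, \<kappa>) \<Rightarrow> Gamma_pow L (1 - b) (- B) \<kappa> s) =
      P3 * Gamma (1 - d1 - of_real \<mu> * s) * Gamma (1 - d2 - of_real \<mu> * s)"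
  proof -
    have "(\<Prod>j\<in>{m..<length ls}. case ?ls ! j of (b, B, \<kappa>) \<Rightarrow> Gamma_pow L (1 - b) (- B) \<kappa> s) = P3"
      unfolding P3_def by (intro prod.cong) (auto simp: nth_append)
    thus ?thesis using m by (simp add: nth_append G)
  qed
  have 4: "(\<Prod>i\<in>{n+2..<length ?us}. case ?us ! i of (a, A, \<kappa>) \<Rightarrow> Gamma_pow L a A \<kappa> s) = P4"
  proof -
    have "length ?us = length us + 2" by simp
    thus ?thesis
      unfolding P4_def by (simp only: prod.shift_bounds_nat_ivl) (intro prod.cong, auto)
  qed
  show ?thesis unfolding I_kernel_def 1 2 3 4 P1_def[symmetric] P2_def[symmetric] P3_def[symmetric]
      P4_def[symmetric]
    by (simp add: rGamma_inverse_Gamma field_simps)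
qed

text \<open>
  This covers the derivatives of order less than \<open>N\<close>.  Where the factors \<open>z\<^sub>i\<close> have modulus at least \<open>1\<close>,
  omitting some of them only makes the product smaller; on the remaining bounded interval \<open>\<phi>\<close> is
  multiplied by a bounded function.
\<close>
lemma integrable_partial_product:
  fixes \<phi> H :: "real \<Rightarrow> complex" and z :: "nat \<Rightarrow> real \<Rightarrow> complex"
  assumes \<phi>: "integrable lborel \<phi>" and H: "continuous_on UNIV H"
    and z: "\<And>i. continuous_on UNIV (z i)"
    and large: "\<And>i \<tau>. \<bar>\<tau>\<bar> \<ge> T \<Longrightarrow> cmod (z i \<tau>) \<ge> 1"
    and top: "integrable lborel (\<lambda>\<tau>. \<phi> \<tau> * H \<tau> * (\<Prod>i<N. z i \<tau>))"
    and k: "k \<le> N"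
  shows "integrable lborel (\<lambda>\<tau>. \<phi> \<tau> * H \<tau> * (\<Prod>i<k. z i \<tau>))"
proof -
  have cont: "continuous_on UNIV (\<lambda>\<tau>. H \<tau> * (\<Prod>i<k. z i \<tau>))" by (intro continuous_intros H z)
  hence "bounded ((\<lambda>\<tau>. H \<tau> * (\<Prod>i<k. z i \<tau>)) ` {-T..T})"
    by (intro compact_imp_bounded compact_continuous_image continuous_on_subset[OF cont]) auto
  then obtain B where B: "\<And>\<tau>. \<tau> \<in> {-T..T} \<Longrightarrow> cmod (H \<tau> * (\<Prod>i<k. z i \<tau>)) \<le> B"
    unfolding bounded_iff by blast
  show ?thesis
  proof (rule Bochner_Integration.integrable_bound)
    show "integrable lborel (\<lambda>\<tau>. \<bar>B\<bar> * cmod (\<phi> \<tau>) + cmod (\<phi> \<tau> * H \<tau> * (\<Prod>i<N. z i \<tau>)))"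
      using \<phi> top by simp
    have [measurable]: "\<phi> \<in> borel_measurable borel" using \<phi> by simp
    have [measurable]: "(\<lambda>\<tau>. H \<tau> * (\<Prod>i<k. z i \<tau>)) \<in> borel_measurable borel"
      by (rule borel_measurable_continuous_onI[OF cont])
    show "(\<lambda>\<tau>. \<phi> \<tau> * H \<tau> * (\<Prod>i<k. z i \<tau>)) \<in> borel_measurable lborel"
      unfolding mult.assoc by measurable
    show "AE \<tau> in lborel. norm (\<phi> \<tau> * H \<tau> * (\<Prod>i<k. z i \<tau>)) \<le>
        norm (\<bar>B\<bar> * cmod (\<phi> \<tau>) + cmod (\<phi> \<tau> * H \<tau> * (\<Prod>i<N. z i \<tau>)))"
    proof (rule AE_I2)
      fix \<tau>
      show "norm (\<phi> \<tau> * H \<tau> * (\<Prod>i<k. z i \<tau>)) \<le> norm (\<bar>B\<bar> * cmod (\<phi> \<tau>) + cmod (\<phi> \<tau> * H \<tau> * (\<Prod>i<N. z i \<tau>)))"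
      proof (cases "\<bar>\<tau>\<bar> \<ge> T")
        case True
        have "(\<Prod>i<N. z i \<tau>) = (\<Prod>i<k. z i \<tau>) * (\<Prod>i\<in>{k..<N}. z i \<tau>)"
          using prod.atLeastLessThan_concat[of 0 k N "\<lambda>i. z i \<tau>"] k by (simp add: atLeast0LessThan)
        moreover have "1 \<le> cmod (\<Prod>i\<in>{k..<N}. z i \<tau>)"
          unfolding prod_norm[symmetric] using large[OF True] by (intro prod_ge_1) auto
        ultimately have "cmod (\<phi> \<tau> * H \<tau> * (\<Prod>i<k. z i \<tau>)) \<le> cmod (\<phi> \<tau> * H \<tau> * (\<Prod>i<N. z i \<tau>))"
          using mult_left_mono[of 1 "cmod (\<Prod>i\<in>{k..<N}. z i \<tau>)" "cmod (\<phi> \<tau> * H \<tau> * (\<Prod>i<k. z i \<tau>))"]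
          by (simp add: norm_mult mult_ac)
        thus ?thesis by (simp add: add_increasing)
      next
        case False
        hence "cmod (H \<tau> * (\<Prod>i<k. z i \<tau>)) \<le> B" by (intro B) auto
        hence "cmod (H \<tau> * (\<Prod>i<k. z i \<tau>)) \<le> \<bar>B\<bar>" by linarith
        hence "cmod (\<phi> \<tau>) * cmod (H \<tau> * (\<Prod>i<k. z i \<tau>)) \<le> cmod (\<phi> \<tau>) * \<bar>B\<bar>" by (intro mult_left_mono) auto
        hence "cmod (\<phi> \<tau> * H \<tau> * (\<Prod>i<k. z i \<tau>)) \<le> \<bar>B\<bar> * cmod (\<phi> \<tau>)" by (simp add: norm_mult mult_ac)
        thus ?thesis by (simp add: add_increasing2)
      qed
    qed
  qed
qed

theorem corollary4p1:
  fixes \<alpha> \<beta> \<gamma> \<rho> a :: complex and \<mu> \<theta> x :: real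
    and m n :: nat and us ls us' ls' :: "triple list" and L :: branches
    and f :: "real \<Rightarrow> complex"
  defines "f \<equiv> \<lambda>t. of_real t powr (\<rho> - 1) * I_function L m n us ls (a * of_real (t powr \<mu>)) \<theta>"
  defines "us' \<equiv> [(1 - \<rho>, \<mu>, 1), (1 - \<alpha> - \<beta> - \<gamma> - \<rho>, \<mu>, 1)] @ us"
  defines "ls' \<equiv> ls @ [(1 - \<gamma> - \<rho>, \<mu>, 1), (1 - \<beta> - \<rho>, \<mu>, 1)]"
  assumes "Re \<alpha> > 0" and "a \<noteq> 0" and "is_arg a \<theta>" and "\<mu> > 0"
    and "Re \<rho> > max 0 (Re (- \<alpha> - \<beta> - \<gamma>))"
    and "Gamma_branches L"
    and "I_params m n us ls" and "I_abs_conv m n us ls \<theta>"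
    and "I_params m (n + 2) us' ls'" and "I_abs_conv m (n + 2) us' ls' \<theta>"
    and "x > 0"
  shows "saigo_derivative_exists \<alpha> \<beta> \<gamma> f \<and>
         saigo_derivative \<alpha> \<beta> \<gamma> f x =
           of_real x powr (\<beta> + \<rho> - 1) *
           I_function L m (n + 2) us' ls' (a * of_real (x powr \<mu>)) \<theta>"
proof -
  define N where "N = saigo_order \<alpha>"
  define \<alpha>' where "\<alpha>' = - \<alpha> + of_nat N"
  define \<beta>' where "\<beta>' = - \<beta> - of_nat N"
  define \<gamma>' where "\<gamma>' = \<alpha> + \<gamma> - of_nat N"
  define \<sigma> where "\<sigma> = (\<lambda>\<tau>. \<rho> - \<i> * of_real (\<mu> * \<tau>))"
  define \<phi> where "\<phi> = I_density L m n us ls a \<theta>"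
  define H where "H = (\<lambda>\<tau>. saigo_multiplier \<alpha>' \<beta>' \<gamma>' (\<sigma> \<tau>))"
  define w where "w = \<rho> - \<beta>' - 1"
  define z where "z = (\<lambda>i \<tau>. w - of_nat i - \<i> * of_real (\<mu> * \<tau>))"
  define P where "P = (\<lambda>k \<tau>. \<phi> \<tau> * H \<tau> * (\<Prod>i<k. z i \<tau>))"
  define \<phi>' where "\<phi>' = I_density L m (n + 2) us' ls' a \<theta>"

  have Re\<rho>: "Re \<rho> > 0" "Re (\<alpha> + \<beta> + \<gamma> + \<rho>) > 0" using assms(8) by auto
  \<comment> \<open>here \<open>N\<close> exceeds \<open>Re \<alpha>\<close>, because it is the integer part plus one\<close>
  have \<alpha>': "Re \<alpha>' > 0"
    using \<open>Re \<alpha> > 0\<close> floor_correct[of "Re \<alpha>"] by (simp add: \<alpha>'_def N_def saigo_order_def) linarith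
  have conv: "Re (\<rho> + \<gamma>' - \<beta>') > 0" using Re\<rho>(2) by (simp add: \<beta>'_def \<gamma>'_def)
  have \<phi>: "integrable lborel \<phi>" unfolding \<phi>_def by (intro integrable_I_density assms)
  have \<phi>': "integrable lborel \<phi>'" unfolding \<phi>'_def by (intro integrable_I_density assms)

  have f: "f t = of_real t powr (\<rho> - 1) * (\<integral>\<tau>. \<phi> \<tau> * of_real t powr (- \<i> * of_real (\<mu> * \<tau>)) \<partial>lborel)"
      if "t > 0" for t
    unfolding f_def \<phi>_def I_function_monomial[OF \<open>a \<noteq> 0\<close> that] ..
  note saigo = saigo_integral_mellin_integral[OF \<phi> \<alpha>' Re\<rho>(1) conv _ f]

  \<comment> \<open>the factors brought down by the \<open>N\<close> derivatives are \<open>\<sigma> + \<beta> + N - 1, \<dots>, \<sigma> + \<beta>\<close>; they cancel the shift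
      by \<open>N\<close>\<close>
  have top: "P N \<tau> = \<phi>' \<tau>" for \<tau>
  proof -
    have m: "m \<le> length ls" using \<open>I_params m n us ls\<close> by (simp add: I_params_def)
    have "(\<Prod>i<N. z i \<tau>) = (\<Prod>i<N. \<sigma> \<tau> + \<beta> + of_nat (N - Suc i))"
      by (intro prod.cong) (auto simp: z_def w_def \<sigma>_def \<beta>'_def of_nat_diff algebra_simps)
    also have "\<dots> = pochhammer (\<sigma> \<tau> + \<beta>) N"
      unfolding pochhammer_prod atLeast0LessThan by (rule prod.nat_diff_reindex)
    moreover have "\<sigma> \<tau> - \<beta>' = \<sigma> \<tau> + \<beta> + of_nat N" by (simp add: \<beta>'_def)
    ultimately have "rGamma (\<sigma> \<tau> + \<beta>) = (\<Prod>i<N. z i \<tau>) * rGamma (\<sigma> \<tau> - \<beta>')"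
      using pochhammer_rGamma[of "\<sigma> \<tau> + \<beta>" N] by (simp only:)
    hence "H \<tau> * (\<Prod>i<N. z i \<tau>) = Gamma (\<sigma> \<tau>) * Gamma (\<sigma> \<tau> + \<alpha> + \<beta> + \<gamma>) * rGamma (\<sigma> \<tau> + \<beta>) * rGamma (\<sigma> \<tau> +
        \<gamma>)"
      unfolding H_def saigo_multiplier_def by (simp add: \<alpha>'_def \<beta>'_def \<gamma>'_def add_ac mult_ac)
    moreover have "I_kernel L m (n + 2) us' ls' (Complex 0 \<tau>) = I_kernel L m n us ls (Complex 0 \<tau>) *
        (Gamma (\<sigma> \<tau>) * Gamma (\<sigma> \<tau> + \<alpha> + \<beta> + \<gamma>) * rGamma (\<sigma> \<tau> + \<gamma>) * rGamma (\<sigma> \<tau> + \<beta>))"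
    proof -
      have "1 - (1 - \<rho>) - of_real \<mu> * Complex 0 \<tau> = \<sigma> \<tau>"
        "1 - (1 - \<alpha> - \<beta> - \<gamma> - \<rho>) - of_real \<mu> * Complex 0 \<tau> = \<sigma> \<tau> + \<alpha> + \<beta> + \<gamma>"
        "1 - (1 - \<gamma> - \<rho>) - of_real \<mu> * Complex 0 \<tau> = \<sigma> \<tau> + \<gamma>"
        "1 - (1 - \<beta> - \<rho>) - of_real \<mu> * Complex 0 \<tau> = \<sigma> \<tau> + \<beta>"
        by (simp_all add: \<sigma>_def complex_eq_iff)
      moreover have "Re (Complex 0 \<tau>) = 0" by simp
      ultimately show ?thesis
        unfolding us'_def ls'_def using I_kernel_extend[OF \<open>Gamma_branches L\<close> _ m] by (simp only:)
    qed
    ultimately show ?thesis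
      unfolding P_def \<phi>_def \<phi>'_def I_density_def mult.assoc by (simp add: mult_ac)
  qed

  have cont: "continuous_on UNIV \<sigma>" "continuous_on UNIV (z i)" for i
    unfolding \<sigma>_def z_def by (intro continuous_intros)+
  have contH: "continuous_on UNIV H"
  proof -
    have "\<sigma> \<tau> \<notin> \<int>\<^sub>\<le>\<^sub>0" "\<sigma> \<tau> + \<gamma>' - \<beta>' \<notin> \<int>\<^sub>\<le>\<^sub>0" for \<tau>
      using Re\<rho>(1) conv by (auto intro!: not_nonpos_Int_Re_pos simp: \<sigma>_def)
    thus ?thesis unfolding H_def saigo_multiplier_def
      by (intro continuous_intros continuous_on_compose2[OF continuous_on_Gamma[of "- \<int>\<^sub>\<le>\<^sub>0"]]
            continuous_on_compose2[OF continuous_on_rGamma[of UNIV]] cont) auto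
  qed
  \<comment> \<open>beyond \<open>T\<close> the imaginary part alone makes every factor \<open>z i\<close> at least \<open>1\<close> in modulus\<close>
  define T where "T = (1 + \<bar>Im w\<bar>) / \<mu>"
  have large: "1 \<le> cmod (z i \<tau>)" if "\<bar>\<tau>\<bar> \<ge> T" for i \<tau>
  proof -
    have "1 + \<bar>Im w\<bar> \<le> \<bar>\<mu> * \<tau>\<bar>" using that \<open>\<mu> > 0\<close> by (simp add: T_def field_simps abs_mult)
    hence "1 \<le> \<bar>Im (z i \<tau>)\<bar>" by (simp add: z_def)
    also have "\<dots> \<le> cmod (z i \<tau>)" by (rule abs_Im_le_cmod)
    finally show ?thesis .
  qed
  have intP: "integrable lborel (P k)" if "k \<le> N" for k
    unfolding P_def
  proof (rule integrable_partial_product[OF \<phi> contH cont(2) large _ that])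
    show "integrable lborel (\<lambda>\<tau>. \<phi> \<tau> * H \<tau> * (\<Prod>i<N. z i \<tau>))" using \<phi>' top by (simp add: P_def)
  qed
  have rec: "P (Suc k) \<tau> = P k \<tau> * (w - of_nat k - \<i> * of_real (\<mu> * \<tau>))" for k \<tau>
    by (simp add: P_def z_def mult.assoc)
  have g: "saigo_integral \<alpha>' \<beta>' \<gamma>' f y = (\<integral>\<tau>. P 0 \<tau> * of_real y powr (w - \<i> * of_real (\<mu> * \<tau>)) \<partial>lborel)"
      if "y > 0" for y
    using saigo(2)[OF that] by (simp add: P_def H_def \<sigma>_def w_def)
  note deriv = iter_deriv_mellin_integral[of N P, OF intP rec g]

  have "saigo_derivative_exists \<alpha> \<beta> \<gamma> f"
    unfolding saigo_derivative_exists_def Let_def N_def[symmetric] \<alpha>'_def[symmetric] \<beta>'_def[symmetric]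
        \<gamma>'_def[symmetric]
    using saigo(1) deriv(2) by blast
  moreover have "saigo_derivative \<alpha> \<beta> \<gamma> f x = of_real x powr (\<beta> + \<rho> - 1) * I_function L m (n +
      2) us' ls' (a * of_real (x powr \<mu>)) \<theta>"
  proof -
    have "saigo_derivative \<alpha> \<beta> \<gamma> f x = iter_deriv N (saigo_integral \<alpha>' \<beta>' \<gamma>' f) x"
      by (simp add: saigo_derivative_def Let_def N_def \<alpha>'_def \<beta>'_def \<gamma>'_def)
    also have "\<dots> = (\<integral>\<tau>. \<phi>' \<tau> * of_real x powr (w - of_nat N - \<i> * of_real (\<mu> * \<tau>)) \<partial>lborel)"
      using deriv(1)[of N x] \<open>x > 0\<close> by (simp add: top)
    also have "\<dots> = (\<integral>\<tau>. of_real x powr (\<beta> + \<rho> - 1) * (\<phi>' \<tau> * of_real x powr (- \<i> * of_real (\<mu> *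
        \<tau>))) \<partial>lborel)"
    proof (rule Bochner_Integration.integral_cong[OF refl])
      fix \<tau> :: real
      have "w - of_nat N - \<i> * of_real (\<mu> * \<tau>) = (\<beta> + \<rho> - 1) + - \<i> * of_real (\<mu> * \<tau>)"
        by (simp add: w_def \<beta>'_def)
      thus "\<phi>' \<tau> * of_real x powr (w - of_nat N - \<i> * of_real (\<mu> * \<tau>)) =
          of_real x powr (\<beta> + \<rho> - 1) * (\<phi>' \<tau> * of_real x powr (- \<i> * of_real (\<mu> * \<tau>)))"
        by (simp only: powr_add mult_ac)
    qed
    also have "\<dots> = of_real x powr (\<beta> + \<rho> - 1) * (\<integral>\<tau>. \<phi>' \<tau> * of_real x powr (- \<i> * of_real (\<mu> * \<tau>)) \<partial>lborel)"
      by (rule integral_mult_right_zero)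
    finally show ?thesis
      unfolding \<phi>'_def I_function_monomial[OF \<open>a \<noteq> 0\<close> \<open>x > 0\<close>] .
  qed
  ultimately show ?thesis by blast
qed

end
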